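(* The optimal production rate $s^*_\lambda(x,t)$, when the deterioration level is $x\in\mathscr{X}$, the time until planned maintenance is $t$ and the base rate is $\lambda$, is decreasing in $x$, decreasing in $t$, and decreasing in $\lambda$.
   Context: "Increasing" and "decreasing" are meant in the weak sense throughout. Model. A system has deterioration level in $\mathscr{X}=\{0,1,\ldots,\xi\}$, where $\xi\in\mathbb{N}$ is the failure level. The decision maker continuously chooses a production rate $s\in\mathscr{S}=[0,\bar s]$, $0<\bar s<\infty$. Under rate $s$, revenue accrues at rate $r(s)$ and the deterioration level jumps up by one according to a Poisson process with instantaneous intensity $\lambda f(s)$, where $\lambda\ge 0$ is the base rate. The deterioration function $f:\mathscr{S}\to\mathbb{R}_+$ and the revenue function $r:\mathscr{S}\to\mathbb{R}$ are continuous and increasing, with $f(0)=0$ and $r(0)\le 0$. The maintenance cost function $c_m:\mathscr{X}\to\mathbb{R}_+$ is increasing and convex. Time is indexed backwards: $t$ denotes the remaining time to the planned maintenance moment, which occurs at $t=0$, and $X_k$ is the deterioration level when $k$ time units remain. $\mathscr{U}$ is the set of non-anticipating production policies under which, almost surely, the deterioration level never exceeds $\xi$; in particular, the system is turned off ($s=0$) once it has reached level $\xi$. For $u\in\mathscr{U}$, with induced production rate $s^u_\lambda(x,k)$ at level $x$ and remaining time $k$, $$J^u_\lambda(x,t)=\mathbb{E}_u\Big[\int_0^t r\big(s^u_\lambda(X_k,k)\big)\,dk-c_m(X_0)\ \Big|\ X_t=x\Big],\qquad J^*_\lambda(x,t)=\sup_{u\in\mathscr{U}}J^u_\lambda(x,t).$$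 Write $\Delta_\lambda(x,t)=J^*_\lambda(x,t)-J^*_\lambda(x+1,t)$ for $x\in\{0,\ldots,\xi-1\}$. The optimal production rate $s^*_\lambda(x,t)$ in state $(x,t)$ with base rate $\lambda$ is, for $x\le\xi-1$, the maximizer in the optimality (HJB) equation, i.e. the solution of $\max_{s\in\mathscr{S}}\big[r(s)-\lambda f(s)\Delta_\lambda(x,t)\big]$, and $s^*_\lambda(\xi,t)=0$. *)

theory Defs
  imports "HOL-Probability.Probability"
begin

text \<open>
  Time is the remaining time, so it decreases along a trajectory, from the starting
  moment t down to the maintenance moment 0.

  A policy prescribes the production rate from what has been observed so far: for
  the current level y, the record h of past deterioration moments, and the current remaining
  time k, it uses the rate u y h k.  When the system starts in level x with t time
  units remaining, h is a function on {x..y} (extended by undefined), where h z is the remaining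
  time at which level z was entered; in particular h x = t.  No other argument
  is available, which makes policies non-anticipating.
\<close>

type_synonym policy = "nat \<Rightarrow> (nat \<Rightarrow> real) \<Rightarrow> real \<Rightarrow> real"

text \<open>
  The jumps are generated from independent standard exponential variables: the jump from
  z to z + 1 occurs as soon as the intensity accumulated since level z was
  entered reaches the z-th of them.  Equivalently, the number of jumps is a unit-rate Poisson
  process evaluated at the accumulated intensity.
\<close>

definition clocks :: "(nat \<Rightarrow> real) measure" where
  "clocks = (\<Pi>\<^sub>M z\<in>(UNIV :: nat set). density lborel (exponential_density 1))"

text \<open>
  The remaining time of the next jump, for intensity q, level entered at
  remaining time a, and exponential variable e.  The value -1 means that there is
  no jump before maintenance; it is propagated, since the set is empty for a = -1.
\<close>

definition next_entry :: "(real \<Rightarrow> real) \<Rightarrow> real \<Rightarrow> real \<Rightarrow> real" where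
  "next_entry q a e =
     (let K = {k \<in> {0..a}. e \<le> (LBINT j:{k..a}. q j)} in if K = {} then -1 else Sup K)"

text \<open>The record of the entry times of the levels x, ..., x + n.\<close>

primrec history ::
  "real \<Rightarrow> (real \<Rightarrow> real) \<Rightarrow> policy \<Rightarrow> nat \<Rightarrow> real \<Rightarrow> (nat \<Rightarrow> real) \<Rightarrow> nat \<Rightarrow> (nat \<Rightarrow> real)" where
  "history lam f u x t \<omega> 0 = (\<lambda>z\<in>{x}. t)"
| "history lam f u x t \<omega> (Suc n) =
     (let h = history lam f u x t \<omega> n
      in h(x + Suc n := next_entry (\<lambda>k. lam * f (u (x + n) h k)) (h (x + n)) (\<omega> (x + n))))"

definition level ::
  "real \<Rightarrow> (real \<Rightarrow> real) \<Rightarrow> policy \<Rightarrow> nat \<Rightarrow> real \<Rightarrow> (nat \<Rightarrow> real) \<Rightarrow> real \<Rightarrow> nat" where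
  "level lam f u x t \<omega> k =
     x + card {n. k \<le> history lam f u x t \<omega> (Suc n) (x + Suc n)}"

definition production_rate ::
  "real \<Rightarrow> (real \<Rightarrow> real) \<Rightarrow> policy \<Rightarrow> nat \<Rightarrow> real \<Rightarrow> (nat \<Rightarrow> real) \<Rightarrow> real \<Rightarrow> real" where
  "production_rate lam f u x t \<omega> k =
     (let y = level lam f u x t \<omega> k in u y (history lam f u x t \<omega> (y - x)) k)"

definition policies :: "nat \<Rightarrow> real \<Rightarrow> (real \<Rightarrow> real) \<Rightarrow> real \<Rightarrow> policy set" where
  "policies \<xi> sbar f lam =
     {u. (\<forall>x y. x \<le> y \<longrightarrow>
            (\<lambda>(h, k). u y h k) \<in> borel_measurable ((\<Pi>\<^sub>M z\<in>{x..y}. borel) \<Otimes>\<^sub>M borel))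
       \<and> (\<forall>y h k. u y h k \<in> {0..sbar})
       \<and> (\<forall>h k. u \<xi> h k = 0)
       \<and> (\<forall>x\<le>\<xi>. \<forall>t\<ge>0. AE \<omega> in clocks. \<forall>k\<in>{0..t}. level lam f u x t \<omega> k \<le> \<xi>)}"

definition policy_value ::
  "(real \<Rightarrow> real) \<Rightarrow> (real \<Rightarrow> real) \<Rightarrow> (nat \<Rightarrow> real) \<Rightarrow> real \<Rightarrow> policy \<Rightarrow> nat \<Rightarrow> real \<Rightarrow> real" where
  "policy_value f r cm lam u x t =
     (\<integral>\<omega>. (LBINT k:{0..t}. r (production_rate lam f u x t \<omega> k))
            - cm (level lam f u x t \<omega> 0) \<partial>clocks)"

definition optimal_value ::
  "nat \<Rightarrow> real \<Rightarrow> (real \<Rightarrow> real) \<Rightarrow> (real \<Rightarrow> real) \<Rightarrow> (nat \<Rightarrow> real) \<Rightarrow> real \<Rightarrow> nat \<Rightarrow> real \<Rightarrow> real" where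
  "optimal_value \<xi> sbar f r cm lam x t =
     (SUP u\<in>policies \<xi> sbar f lam. policy_value f r cm lam u x t)"

definition value_difference ::
  "nat \<Rightarrow> real \<Rightarrow> (real \<Rightarrow> real) \<Rightarrow> (real \<Rightarrow> real) \<Rightarrow> (nat \<Rightarrow> real) \<Rightarrow> real \<Rightarrow> nat \<Rightarrow> real \<Rightarrow> real" where
  "value_difference \<xi> sbar f r cm lam x t =
     optimal_value \<xi> sbar f r cm lam x t - optimal_value \<xi> sbar f r cm lam (Suc x) t"

text \<open>The maximizers in the optimality equation; they need not be unique.\<close>

definition optimal_rates ::
  "nat \<Rightarrow> real \<Rightarrow> (real \<Rightarrow> real) \<Rightarrow> (real \<Rightarrow> real) \<Rightarrow> (nat \<Rightarrow> real) \<Rightarrow> real \<Rightarrow> nat \<Rightarrow> real \<Rightarrow> real set" where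
  "optimal_rates \<xi> sbar f r cm lam x t =
     (if x < \<xi>
      then {s. is_arg_max (\<lambda>s. r s - lam * f s * value_difference \<xi> sbar f r cm lam x t)
                 (\<lambda>s. s \<in> {0..sbar}) s}
      else {0})"

text \<open>
  The optimal rate, with ties broken by select: Sup takes the largest maximizer and
  Inf the smallest.  If the maximizer is unique, both yield it.
\<close>

definition optimal_rate ::
  "(real set \<Rightarrow> real) \<Rightarrow> nat \<Rightarrow> real \<Rightarrow> (real \<Rightarrow> real) \<Rightarrow> (real \<Rightarrow> real) \<Rightarrow> (nat \<Rightarrow> real)
     \<Rightarrow> real \<Rightarrow> nat \<Rightarrow> real \<Rightarrow> real" where
  "optimal_rate select \<xi> sbar f r cm lam x t = select (optimal_rates \<xi> sbar f r cm lam x t)"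

end

theory Submission imports Defs begin

text \<open>
  Let H d be the maximum of r s - d * f s over the rates s; it is decreasing in d, and so are the
  largest and the smallest maximizer. It therefore suffices that lam * gap V x t increases in x, t
  and lam, where gap V x t = V x t - V (x + 1) t for the value function V.

  The value function solves the triangular system V_x' = H (lam * gap V x), with V_\<xi>' = r 0.
  This is verified by a martingale argument: along any policy, V at the end plus the integral of
  a running reward that dominates the revenue has mean V x t, because each jump is compensated
  by the intensity accumulated before it; the domination is an equality for the feedback
  policy that maximizes the Hamiltonian.

  For x + 1 < \<xi> the gaps satisfy (gap V x)' = H (lam * gap V x) - H (lam * gap V (x + 1)), and
  r 0 replaces the last term for x + 1 = \<xi>. Since H is decreasing, comparison goes the easy way:
  a difference of gaps that becomes positive stops increasing. Descending from the failure level,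
  this yields in turn gap V x \<le> gap V (x + 1), then (gap V x)' \<ge> 0, and then monotonicity of
  lam * gap V x in lam.
\<close>

text \<open>No regularity of the supremum over policies is ever shown: \<open>V\<close> is built
  from differential equations before it is identified with the optimal value. Although
  \<open>f\<close> and \<open>r\<close> are merely continuous and the maximizers may jump as the
  price \<open>d\<close> varies, these equations are well-posed, because \<open>H\<close> is
  Lipschitz.

  Policies may depend on the whole history, so the controlled level need not be Markov. Given the
  clocks of the earlier levels, however, the intensity in the current level is a fixed function of
  time, and the next jump involves a single exponential variable. Averaging over that one clock
  takes the place of filtrations and conditional expectations. Shutdown at failure leaves finitely
  many increments, so no limit is taken.

  The monotonicity results are chained: the order of the gaps in the level uses the sign of the
  derivative one level up, this sign uses the order of the gaps at its own level, and the comparison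
  in \<open>lam\<close> uses the sign because \<open>lam\<close> also multiplies the derivative of
  the scaled gap.\<close>

section \<open>Comparison and existence for scalar differential equations\<close>

text \<open>If \<open>p t\<close> were positive, let \<open>Sup S\<close> be the last moment up to
  \<open>t\<close> with a nonpositive value. From there to \<open>t\<close> the function is
  positive, so by the mean value theorem it cannot rise. The sign of \<open>p'\<close> is required
  only where \<open>p\<close> is positive, which is exactly where antitonicity of \<open>H\<close>
  will order two derivatives.\<close>

lemma nonpos_if_nonincreasing_above_zero:
  fixes p p' :: "real \<Rightarrow> real"
  assumes deriv: "\<And>t. t \<in> {0..T} \<Longrightarrow> (p has_real_derivative p' t) (at t within {0..T})"
    and init: "p 0 \<le> 0"
    and decr: "\<And>t. t \<in> {0..T} \<Longrightarrow> 0 < p t \<Longrightarrow> p' t \<le> 0"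
    and t: "t \<in> {0..T}"
  shows "p t \<le> 0"
proof (rule ccontr)
  assume "\<not> p t \<le> 0"
  define S where "S = {s \<in> {0..t}. p s \<le> 0}"
  have deriv_t: "(p has_real_derivative p' s) (at s within {a..b})" if "s \<in> {a..b}" "0 \<le> a" "b \<le> t" for s a b
    by (rule DERIV_subset[OF deriv]) (use that t in auto)
  have "continuous_on {0..t} p"
    using deriv_t[of _ 0 t] by (intro continuous_on_vector_derivative[of _ _ p'])
      (simp add: has_real_derivative_iff_has_vector_derivative)
  then have "closed S"
    unfolding S_def by (intro continuous_on_closed_Collect_le continuous_on_const) auto
  moreover have "bdd_above S" "S \<noteq> {}"
    using init t by (auto simp: S_def intro!: bdd_aboveI[of _ t] exI[of _ 0])
  ultimately have "Sup S \<in> S"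
    by (intro closed_contains_Sup)
  then have s: "0 \<le> Sup S" "Sup S < t" "p (Sup S) \<le> 0"
    using \<open>\<not> p t \<le> 0\<close> unfolding S_def by (auto simp: less_le)
  obtain z where z: "z \<in> {Sup S<..<t}" "p t - p (Sup S) = (t - Sup S) * p' z"
    using mvt_simple[of "Sup S" t p "\<lambda>x. (*) (p' x)"] deriv_t[of _ "Sup S" t] s
    by (auto simp: has_field_derivative_def mult.commute)
  have "0 < p z"
  proof (rule ccontr)
    assume "\<not> 0 < p z"
    then have "z \<in> S"
      using z s by (auto simp: S_def)
    then show False
      using cSup_upper[OF _ \<open>bdd_above S\<close>] z by force
  qed
  then have "p' z \<le> 0"
    using decr[of z] z s t by auto
  then have "(t - Sup S) * p' z \<le> 0"
    using s by (simp add: mult_nonneg_nonpos)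
  then show False
    using z s \<open>\<not> p t \<le> 0\<close> by linarith
qed

text \<open>
  In the norm weighted by exp (- 2 L t), Picard's integral operator halves distances on any
  time horizon.
\<close>

lemma lipschitz_ode_solution:
  fixes F :: "real \<Rightarrow> real \<Rightarrow> real"
  assumes cont: "\<And>y. continuous_on UNIV y \<Longrightarrow> continuous_on UNIV (\<lambda>t. F t (y t))"
    and lip: "\<And>t y z. \<bar>F t y - F t z\<bar> \<le> L * \<bar>y - z\<bar>"
    and "0 < L" "0 \<le> T"
  obtains y where "continuous_on UNIV y" "y 0 = c"
    "\<And>t. t \<in> {0..T} \<Longrightarrow> (y has_real_derivative F t (y t)) (at t within {0..T})"
proof -
  \<comment> \<open>Clamping time to the horizon turns functions on \<open>{0..T}\<close> into
    bounded continuous functions on the whole line, a complete metric space that is available as a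
    type.\<close>
  define cl where "cl t = max 0 (min t T)" for t :: real
  have cl: "cl t \<in> {0..T}" for t
    using \<open>0 \<le> T\<close> by (auto simp: cl_def)
  have cl_id: "t \<in> {0..T} \<Longrightarrow> cl t = t" for t
    by (auto simp: cl_def)
  have cl_cont: "continuous_on UNIV cl"
    unfolding cl_def by (intro continuous_intros)
  \<comment> \<open>The unknown is \<open>g s = exp (- (2 * L * s)) * y s\<close> instead of
    \<open>y\<close>, so that the plain supremum distance of \<open>g\<close> is the weighted
    distance of \<open>y\<close>.\<close>
  define G where "G g s = F s (exp (2 * L * s) * g s)" for g :: "real \<Rightarrow> real" and s
  have G_cont: "continuous_on UNIV (G g)" if "continuous_on UNIV g" for g
    unfolding G_def using that by (intro cont continuous_intros)
  define I where "I g t = c + integral {0..t} (G g)" for g t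
  have I_cont: "continuous_on {0..T} (I g)" if "continuous_on UNIV g" for g
    unfolding I_def
    by (intro continuous_intros indefinite_integral_continuous_1 integrable_continuous_real
        continuous_on_subset[OF G_cont[OF that]]) auto
  have I_cl: "continuous_on UNIV (\<lambda>t. I g (cl t))" if "continuous_on UNIV g" for g
    using cl by (intro continuous_on_compose2[OF I_cont[OF that] cl_cont]) auto
  define \<Phi> where "\<Phi> g t = exp (- (2 * L * cl t)) * I g (cl t)" for g t
  have "\<Phi> g \<in> bcontfun" if g: "continuous_on UNIV g" for g
  proof -
    have "bounded ((\<lambda>t. exp (- (2 * L * t)) * I g t) ` {0..T})"
      by (intro compact_imp_bounded compact_continuous_image continuous_intros I_cont g) auto
    moreover have "range (\<Phi> g) \<subseteq> (\<lambda>t. exp (- (2 * L * t)) * I g t) ` {0..T}"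
      using cl unfolding \<Phi>_def by blast
    ultimately have "bounded (range (\<Phi> g))"
      using bounded_subset by blast
    then show ?thesis
      unfolding bcontfun_def using I_cl[OF g] cl_cont
      by (auto simp: \<Phi>_def intro!: continuous_intros)
  qed
  then have apply_\<Phi>: "apply_bcontfun (Bcontfun (\<Phi> (apply_bcontfun g))) = \<Phi> (apply_bcontfun g)" for g
    by (simp add: Bcontfun_inverse)
  have contr: "dist (Bcontfun (\<Phi> (apply_bcontfun g))) (Bcontfun (\<Phi> (apply_bcontfun h))) \<le> (1/2) * dist g h"
    for g h :: "real \<Rightarrow>\<^sub>C real"
  proof (rule dist_bound)
    fix t
    let ?g = "apply_bcontfun g" and ?h = "apply_bcontfun h" and ?D = "dist g h" and ?t = "cl t"
    have int: "G (apply_bcontfun k) integrable_on {0..?t}" for k :: "real \<Rightarrow>\<^sub>C real"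
      by (intro integrable_continuous_real continuous_on_subset[OF G_cont]) auto
    \<comment> \<open>The exponent \<open>2 * L\<close> is chosen for this integral: the Lipschitz
      constant \<open>L\<close> cancels and the contraction factor \<open>1/2\<close>
      remains.\<close>
    have bnd: "((\<lambda>s. L * exp (2 * L * s) * ?D) has_integral
        (exp (2 * L * ?t) * ?D / 2 - exp (2 * L * 0) * ?D / 2)) {0..?t}"
      using \<open>0 < L\<close> cl[of t]
      by (intro fundamental_theorem_of_calculus)
         (auto intro!: derivative_eq_intros simp flip: has_real_derivative_iff_has_vector_derivative)
    have "norm (G ?g s - G ?h s) \<le> L * exp (2 * L * s) * ?D" for s
    proof -
      have "norm (G ?g s - G ?h s) \<le> L * (exp (2 * L * s) * \<bar>?g s - ?h s\<bar>)"
        using lip[of s "exp (2 * L * s) * ?g s" "exp (2 * L * s) * ?h s"]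
        by (simp add: G_def abs_mult flip: right_diff_distrib)
      also have "\<dots> \<le> L * (exp (2 * L * s) * ?D)"
        using dist_bounded[of g s h] \<open>0 < L\<close> by (auto intro!: mult_left_mono simp: dist_real_def)
      finally show ?thesis by (simp add: mult.assoc)
    qed
    then have "norm (integral {0..?t} (\<lambda>s. G ?g s - G ?h s)) \<le> integral {0..?t} (\<lambda>s. L * exp (2 * L * s) * ?D)"
      using bnd int by (intro integral_norm_bound_integral integrable_diff) auto
    also have "\<dots> = (exp (2 * L * ?t) - 1) * ?D / 2"
      unfolding integral_unique[OF bnd] by (simp add: left_diff_distrib diff_divide_distrib)
    finally have "\<bar>I ?g ?t - I ?h ?t\<bar> \<le> (exp (2 * L * ?t) - 1) * ?D / 2"
      using int by (simp add: I_def integral_diff)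
    also have "\<dots> \<le> exp (2 * L * ?t) * ?D / 2"
      by (simp add: divide_right_mono mult_right_mono)
    finally have "exp (- (2 * L * ?t)) * \<bar>I ?g ?t - I ?h ?t\<bar> \<le> exp (- (2 * L * ?t)) * (exp (2 * L * ?t) * ?D / 2)"
      by (intro mult_left_mono) auto
    also have "\<dots> = 1/2 * ?D"
      by (simp add: exp_minus)
    finally show "dist (apply_bcontfun (Bcontfun (\<Phi> ?g)) t) (apply_bcontfun (Bcontfun (\<Phi> ?h)) t) \<le> 1/2 * ?D"
      by (simp add: apply_\<Phi> \<Phi>_def dist_real_def abs_mult flip: right_diff_distrib)
  qed
  have "\<exists>!g. Bcontfun (\<Phi> (apply_bcontfun g)) = (g :: real \<Rightarrow>\<^sub>C real)"
    by (rule banach_fix_type[of "1/2"]) (use contr in auto)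
  then obtain g :: "real \<Rightarrow>\<^sub>C real" where g: "\<Phi> (apply_bcontfun g) = apply_bcontfun g"
    using apply_\<Phi> by metis
  define y where "y t = I (apply_bcontfun g) (cl t)" for t
  have Gy: "G (apply_bcontfun g) s = F s (y s)" if "s \<in> {0..T}" for s
    using that by (subst g[symmetric]) (simp add: G_def \<Phi>_def y_def cl_id exp_minus flip: mult.assoc)
  show thesis
  proof (rule that[of y])
    show "continuous_on UNIV y"
      unfolding y_def by (intro I_cl) auto
    show "y 0 = c"
      using \<open>0 \<le> T\<close> by (simp add: y_def cl_id I_def)
    fix t assume t: "t \<in> {0..T}"
    have "((\<lambda>t. c + integral {0..t} (G (apply_bcontfun g))) has_real_derivative 0 + G (apply_bcontfun g) t)
        (at t within {0..T})"
      using t by (intro DERIV_add DERIV_const integral_has_real_derivative continuous_on_subset[OF G_cont]) auto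
    moreover have "y s = c + integral {0..s} (G (apply_bcontfun g))" if "s \<in> {0..T}" for s
      using that by (simp add: y_def I_def cl_id)
    ultimately show "(y has_real_derivative F t (y t)) (at t within {0..T})"
      using t Gy[OF t] by (auto intro: has_field_derivative_transform_within[of _ _ _ _ 1 y])
  qed
qed

section \<open>The Hamiltonian and its maximizers\<close>

locale production =
  fixes sbar :: real and f r :: "real \<Rightarrow> real"
  assumes sbar_pos: "0 < sbar"
    and f_cont: "continuous_on {0..sbar} f" and f_mono: "mono_on {0..sbar} f"
    and f_nonneg: "\<And>s. s \<in> {0..sbar} \<Longrightarrow> 0 \<le> f s" and f_0: "f 0 = 0"
    and r_cont: "continuous_on {0..sbar} r"
begin

definition H :: "real \<Rightarrow> real" where
  "H d = (SUP s\<in>{0..sbar}. r s - d * f s)"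

definition maximizers :: "real \<Rightarrow> real set" where
  "maximizers d = {s \<in> {0..sbar}. r s - d * f s = H d}"

lemma objective_cont: "continuous_on {0..sbar} (\<lambda>s. r s - d * f s)"
  by (intro continuous_intros f_cont r_cont)

lemma H_attained:
  obtains s where "s \<in> {0..sbar}" "r s - d * f s = H d" "\<And>z. z \<in> {0..sbar} \<Longrightarrow> r z - d * f z \<le> r s - d * f s"
proof -
  obtain s where s: "s \<in> {0..sbar}" "\<And>z. z \<in> {0..sbar} \<Longrightarrow> r z - d * f z \<le> r s - d * f s"
    using continuous_attains_sup[of "{0..sbar}" "\<lambda>s. r s - d * f s"] objective_cont sbar_pos by auto
  moreover from this have "H d = r s - d * f s"
    unfolding H_def by (intro cSup_eq_maximum) auto
  ultimately show thesis
    using that by auto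
qed

lemma H_upper: "s \<in> {0..sbar} \<Longrightarrow> r s - d * f s \<le> H d"
  by (metis H_attained)

text \<open>Rate \<open>0\<close> is available at every price, since \<open>f 0 = 0\<close>. As
  \<open>r 0\<close> is the slope of the value at the failure level, this starts the descent from
  that level.\<close>

lemma r_0_le_H: "r 0 \<le> H d"
  using H_upper[of 0 d] sbar_pos f_0 by simp

lemma H_antimono: "H d' \<le> H d" if "d \<le> d'"
proof -
  obtain s where s: "s \<in> {0..sbar}" "r s - d' * f s = H d'"
    using H_attained by metis
  have "d * f s \<le> d' * f s"
    using that f_nonneg[OF s(1)] by (intro mult_right_mono)
  then show ?thesis
    using H_upper[OF s(1), of d] s(2) by linarith
qed

text \<open>A maximizer at one price is a candidate at the other, so \<open>H\<close> changes by at
  most \<open>f s\<close> times the change in price; no regularity of the maximizer in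
  \<open>d\<close> is involved.\<close>

lemma H_lipschitz: "\<bar>H d - H d'\<bar> \<le> f sbar * \<bar>d - d'\<bar>"
proof -
  have *: "H d - H d' \<le> f sbar * \<bar>d - d'\<bar>" for d d'
  proof -
    obtain s where s: "s \<in> {0..sbar}" "r s - d * f s = H d"
      using H_attained by metis
    have "H d - H d' \<le> f s * (d' - d)"
      using H_upper[OF s(1), of d'] s(2) by (simp add: algebra_simps)
    also have "\<dots> \<le> f s * \<bar>d - d'\<bar>"
      using f_nonneg[OF s(1)] by (intro mult_left_mono) auto
    also have "\<dots> \<le> f sbar * \<bar>d - d'\<bar>"
      using s(1) sbar_pos by (intro mult_right_mono mono_onD[OF f_mono]) auto
    finally show ?thesis .
  qed
  show ?thesis
    using *[of d d'] *[of d' d] by (simp add: abs_le_iff abs_minus_commute)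
qed

lemma H_cont: "continuous_on UNIV H"
proof -
  have "(f sbar)-lipschitz_on UNIV H"
    using H_lipschitz f_nonneg[of sbar] sbar_pos by (auto intro!: lipschitz_onI simp: dist_real_def)
  then show ?thesis
    by (rule lipschitz_on_continuous_on)
qed

lemma maximizers_nonempty: "maximizers d \<noteq> {}"
  using H_attained[of d] unfolding maximizers_def by blast

text \<open>An upper level set of a continuous function on a compact interval. Compactness is what
  makes \<open>Sup\<close> and \<open>Inf\<close> choose maximizers.\<close>

lemma maximizers_compact: "compact (maximizers d)"
proof -
  have "maximizers d = {s \<in> {0..sbar}. H d \<le> r s - d * f s}"
    unfolding maximizers_def using H_upper[of _ d] by (auto intro: order.antisym)
  then have "closed (maximizers d)"
    using continuous_on_closed_Collect_le[OF continuous_on_const objective_cont, of "H d" d] by simp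
  moreover have "bounded (maximizers d)"
    by (rule bounded_subset[of "{0..sbar}"]) (auto simp: maximizers_def)
  ultimately show ?thesis
    by (simp add: compact_eq_bounded_closed)
qed

lemma arg_max_eq_maximizers: "{s. is_arg_max (\<lambda>s. r s - d * f s) (\<lambda>s. s \<in> {0..sbar}) s} = maximizers d"
proof -
  obtain s where s: "s \<in> {0..sbar}" "r s - d * f s = H d"
    using H_attained by metis
  show ?thesis
    unfolding maximizers_def is_arg_max_def using s
    by (auto simp: not_less H_upper intro!: order.antisym)
qed

lemma select_maximizers: "select \<in> {Sup, Inf} \<Longrightarrow> select (maximizers d) \<in> maximizers d"
  using closed_contains_Sup[of "maximizers d"] closed_contains_Inf[of "maximizers d"]
    maximizers_compact[of d] maximizers_nonempty[of d]
  by (auto simp: compact_imp_closed bounded_imp_bdd_above bounded_imp_bdd_below compact_imp_bounded)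

text \<open>The exchange argument of monotone comparative statics. Adding the two optimality
  inequalities gives \<open>(d' - d) * (f s' - f s) \<le> 0\<close>, whereas monotonicity of
  \<open>f\<close> gives the reverse, so neither inequality is strict.\<close>

lemma maximizers_exchange:
  assumes "d \<le> d'" "s \<in> maximizers d" "s' \<in> maximizers d'" "s \<le> s'"
  shows "s \<in> maximizers d'" "s' \<in> maximizers d"
proof -
  have mem: "s \<in> {0..sbar}" "s' \<in> {0..sbar}"
    using assms by (auto simp: maximizers_def)
  then have "0 \<le> (d' - d) * (f s' - f s)"
    using assms mono_onD[OF f_mono] by (intro mult_nonneg_nonneg) auto
  then have "r s - d * f s = r s' - d * f s' \<and> r s - d' * f s = r s' - d' * f s'"
    using H_upper[OF mem(1), of d'] H_upper[OF mem(2), of d] assms(2,3)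
    unfolding maximizers_def by (simp add: algebra_simps)
  then show "s \<in> maximizers d'" "s' \<in> maximizers d"
    using mem assms(2,3) by (auto simp: maximizers_def)
qed

text \<open>If the selected maximizers were in the wrong order, the exchange would yield a maximizer
  at \<open>d\<close> above the \<open>Sup\<close>, or a maximizer at \<open>d'\<close> below the
  \<open>Inf\<close>.\<close>

lemma select_maximizers_antimono:
  assumes "select \<in> {Sup, Inf}" "d \<le> d'"
  shows "select (maximizers d') \<le> select (maximizers d)"
proof (rule ccontr)
  assume *: "\<not> ?thesis"
  have "select (maximizers d) \<in> maximizers d'" "select (maximizers d') \<in> maximizers d"
    using maximizers_exchange[OF assms(2) select_maximizers[OF assms(1)] select_maximizers[OF assms(1)]] *
    by auto
  moreover have "bdd_above (maximizers d)" "bdd_below (maximizers d')"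
    using maximizers_compact by (auto simp: bounded_imp_bdd_above bounded_imp_bdd_below compact_imp_bounded)
  ultimately show False
    using * assms(1) by (auto simp: cSup_upper cInf_lower)
qed

end

section \<open>The optimality equation\<close>

lemma nondecreasing_if_deriv_nonneg_within:
  fixes p p' :: "real \<Rightarrow> real"
  assumes deriv: "\<And>t. t \<in> {0..T} \<Longrightarrow> (p has_real_derivative p' t) (at t within {0..T})"
    and nonneg: "\<And>t. t \<in> {0..T} \<Longrightarrow> 0 \<le> p' t"
    and st: "0 \<le> s" "s \<le> t" "t \<le> T"
  shows "p s \<le> p t"
proof (cases "s = t")
  case False
  have "(p has_real_derivative p' x) (at x within {s..t})" if "x \<in> {s..t}" for x
    by (rule DERIV_subset[OF deriv]) (use that st in auto)
  then obtain z where "z \<in> {s<..<t}" "p t - p s = (t - s) * p' z"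
    using mvt_simple[of s t p "\<lambda>x. (*) (p' x)"] False st
    by (auto simp: has_field_derivative_def mult.commute)
  then show ?thesis
    using nonneg[of z] st by (simp add: algebra_simps) (smt (verit) mult_nonneg_nonneg mult.commute right_diff_distrib)
qed simp

context production
begin

text \<open>
  Levels beyond the failure level, which are almost surely not reached, are given its value, so
  that sums over levels need no case distinction.
\<close>

definition hjb_solution :: "nat \<Rightarrow> (nat \<Rightarrow> real) \<Rightarrow> real \<Rightarrow> real \<Rightarrow> (nat \<Rightarrow> real \<Rightarrow> real) \<Rightarrow> bool" where
  "hjb_solution \<xi> cm lam T V \<longleftrightarrow>
     (\<forall>y. continuous_on UNIV (V y)) \<and> (\<forall>y\<le>\<xi>. V y 0 = - cm y) \<and> (\<forall>y\<ge>\<xi>. V y = V \<xi>)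
   \<and> (\<forall>y<\<xi>. \<forall>t\<in>{0..T}.
        (V y has_real_derivative H (lam * (V y t - V (Suc y) t))) (at t within {0..T}))
   \<and> (\<forall>t\<in>{0..T}. (V \<xi> has_real_derivative r 0) (at t within {0..T}))"

lemma
  assumes "hjb_solution \<xi> cm lam T V"
  shows hjb_solution_cont: "continuous_on UNIV (V y)"
    and hjb_solution_init: "y \<le> \<xi> \<Longrightarrow> V y 0 = - cm y"
    and hjb_solution_beyond: "\<xi> \<le> y \<Longrightarrow> V y = V \<xi>"
    and hjb_solution_deriv: "y < \<xi> \<Longrightarrow> t \<in> {0..T} \<Longrightarrow>
      (V y has_real_derivative H (lam * (V y t - V (Suc y) t))) (at t within {0..T})"
    and hjb_solution_deriv_failed: "t \<in> {0..T} \<Longrightarrow> (V \<xi> has_real_derivative r 0) (at t within {0..T})"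
  using assms unfolding hjb_solution_def by blast+

lemma hjb_solution_exists:
  assumes "0 \<le> lam" "0 \<le> T"
  obtains V where "hjb_solution \<xi> cm lam T V"
proof -
  \<comment> \<open>\<open>n\<close> counts the levels below failure. \<open>Q w y\<close> says that
    \<open>y\<close> solves the scalar equation of a level whose next worse level has value
    \<open>w\<close>, so solutions are chosen one after another.\<close>
  define P where "P n w \<longleftrightarrow> continuous_on UNIV w \<and> w 0 = - cm (\<xi> - n) \<and> (n = 0 \<longrightarrow> w = (\<lambda>t. r 0 * t - cm \<xi>))"
    for n :: nat and w :: "real \<Rightarrow> real"
  define Q where "Q w y \<longleftrightarrow> (\<forall>t\<in>{0..T}. (y has_real_derivative H (lam * (y t - w t))) (at t within {0..T}))"
    for w y :: "real \<Rightarrow> real"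
  have step: "\<exists>y. P (Suc n) y \<and> Q w y" if "P n w" for n w
  proof -
    have w: "continuous_on UNIV w"
      using that by (simp add: P_def)
    have H_comp: "continuous_on UNIV (\<lambda>t. H (g t))" if "continuous_on UNIV g" for g :: "real \<Rightarrow> real"
      using continuous_on_compose2[OF H_cont that] by simp
    \<comment> \<open>The summand \<open>1\<close> only makes the constant positive, since
      \<open>lam\<close> or \<open>f sbar\<close> may be \<open>0\<close>.\<close>
    have lip: "\<bar>H (lam * (y - w t)) - H (lam * (z - w t))\<bar> \<le> (f sbar * lam + 1) * \<bar>y - z\<bar>" for t y z
    proof -
      have "\<bar>H (lam * (y - w t)) - H (lam * (z - w t))\<bar> \<le> f sbar * \<bar>lam * (y - w t) - lam * (z - w t)\<bar>"
        by (rule H_lipschitz)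
      also have "lam * (y - w t) - lam * (z - w t) = lam * (y - z)"
        by (simp add: algebra_simps)
      also have "f sbar * \<bar>lam * (y - z)\<bar> = f sbar * lam * \<bar>y - z\<bar>"
        using \<open>0 \<le> lam\<close> by (simp add: abs_mult)
      also have "\<dots> \<le> (f sbar * lam + 1) * \<bar>y - z\<bar>"
        by (simp add: distrib_right)
      finally show ?thesis .
    qed
    have pos: "0 < f sbar * lam + 1"
      using \<open>0 \<le> lam\<close> f_nonneg[of sbar] sbar_pos by (simp add: add_nonneg_pos)
    show ?thesis
      by (rule lipschitz_ode_solution[of "\<lambda>t y. H (lam * (y - w t))" "f sbar * lam + 1" T "- cm (\<xi> - Suc n)"])
         (auto intro!: H_comp continuous_intros w lip pos \<open>0 \<le> T\<close> simp: P_def Q_def)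
  qed
  have "\<exists>x. P 0 x"
    by (auto simp: P_def intro!: continuous_intros)
  then obtain W where W: "\<And>n. P n (W n)" "\<And>n. Q (W n) (W (Suc n))"
    using dependent_nat_choice[of P "\<lambda>n. Q"] step by metis
  have W_cont: "continuous_on UNIV (W n)" and W_init: "W n 0 = - cm (\<xi> - n)" for n
    using W(1)[of n] unfolding P_def by blast+
  \<comment> \<open>Truncated subtraction gives all levels from \<open>\<xi>\<close> on the function
    \<open>W 0\<close>, as \<open>hjb_solution\<close> demands.\<close>
  have "hjb_solution \<xi> cm lam T (\<lambda>y. W (\<xi> - y))"
    unfolding hjb_solution_def
  proof (intro conjI allI impI ballI)
    fix y t assume "y < \<xi>" "t \<in> {0..T}"
    then show "(W (\<xi> - y) has_real_derivative H (lam * (W (\<xi> - y) t - W (\<xi> - Suc y) t))) (at t within {0..T})"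
      using W(2)[of "\<xi> - Suc y"] by (simp add: Q_def Suc_diff_Suc)
  next
    fix t
    have "W 0 = (\<lambda>t. r 0 * t - cm \<xi>)"
      using W(1)[of 0] unfolding P_def by blast
    then show "(W (\<xi> - \<xi>) has_real_derivative r 0) (at t within {0..T})"
      by (auto intro!: derivative_eq_intros)
  qed (simp_all add: W_cont W_init)
  then show thesis
    by (rule that)
qed

section \<open>Monotonicity of the gaps in level, time and base rate\<close>

abbreviation gap :: "(nat \<Rightarrow> real \<Rightarrow> real) \<Rightarrow> nat \<Rightarrow> real \<Rightarrow> real" where
  "gap V y t \<equiv> V y t - V (Suc y) t"

definition gap_rate :: "nat \<Rightarrow> real \<Rightarrow> (nat \<Rightarrow> real \<Rightarrow> real) \<Rightarrow> nat \<Rightarrow> real \<Rightarrow> real" where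
  "gap_rate \<xi> lam V y t =
     H (lam * gap V y t) - (if Suc y < \<xi> then H (lam * gap V (Suc y) t) else r 0)"

lemma gap_deriv:
  assumes "hjb_solution \<xi> cm lam T V" "y < \<xi>" "t \<in> {0..T}"
  shows "(gap V y has_real_derivative gap_rate \<xi> lam V y t) (at t within {0..T})"
proof (cases "Suc y < \<xi>")
  case True
  show ?thesis
    using DERIV_diff[OF hjb_solution_deriv[OF assms] hjb_solution_deriv[OF assms(1) True assms(3)]] True
    by (simp add: gap_rate_def)
next
  case False
  then have "\<xi> = Suc y"
    using assms by simp
  then show ?thesis
    using DERIV_diff[OF hjb_solution_deriv[OF assms] hjb_solution_deriv_failed[OF assms(1,3)]]
    by (simp add: gap_rate_def)
qed

text \<open>The two claims need each other: nonnegativity of \<open>gap_rate\<close> at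
  \<open>Suc y\<close> gives the order of the gaps at \<open>y\<close> and \<open>Suc y\<close>,
  which through antitonicity of \<open>H\<close> gives nonnegativity at \<open>y\<close>. Convexity
  of \<open>cm\<close> is the order of the gaps at time \<open>0\<close>.\<close>

lemma gap_rate_nonneg_and_gap_increasing:
  assumes sol: "hjb_solution \<xi> cm lam T V" and "0 \<le> lam"
    and convex: "\<And>x. x + 2 \<le> \<xi> \<Longrightarrow> cm (x + 1) - cm x \<le> cm (x + 2) - cm (x + 1)"
    and "y < \<xi>"
  shows "(\<forall>t\<in>{0..T}. 0 \<le> gap_rate \<xi> lam V y t)
    \<and> (Suc y < \<xi> \<longrightarrow> (\<forall>t\<in>{0..T}. gap V y t \<le> gap V (Suc y) t))"
  using \<open>y < \<xi>\<close>
proof (induction "\<xi> - y" arbitrary: y rule: less_induct)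
  case less
  show ?case
  proof (cases "Suc y < \<xi>")
    case False
    then show ?thesis
      using r_0_le_H by (simp add: gap_rate_def)
  next
    case True
    have IH: "0 \<le> gap_rate \<xi> lam V (Suc y) t" if "t \<in> {0..T}" for t
      using less(1)[of "Suc y"] True that by auto
    have le: "gap V y t \<le> gap V (Suc y) t" if t: "t \<in> {0..T}" for t
    proof -
      have "gap V y t - gap V (Suc y) t \<le> 0"
      proof (rule nonpos_if_nonincreasing_above_zero[of T "\<lambda>t. gap V y t - gap V (Suc y) t"
            "\<lambda>t. gap_rate \<xi> lam V y t - gap_rate \<xi> lam V (Suc y) t"])
        show "gap V y 0 - gap V (Suc y) 0 \<le> 0"
          using convex[of y] True by (simp add: hjb_solution_init[OF sol])
        fix s assume s: "s \<in> {0..T}"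
        show "((\<lambda>t. gap V y t - gap V (Suc y) t) has_real_derivative
            gap_rate \<xi> lam V y s - gap_rate \<xi> lam V (Suc y) s) (at s within {0..T})"
          using gap_deriv[OF sol _ s] True less.prems by (intro DERIV_diff) auto
        \<comment> \<open>Here \<open>H_antimono\<close> makes the rate at \<open>y\<close>
          nonpositive, while the rate at \<open>Suc y\<close> is nonnegative by
          \<open>IH\<close>.\<close>
        assume "0 < gap V y s - gap V (Suc y) s"
        then have "H (lam * gap V y s) \<le> H (lam * gap V (Suc y) s)"
          using \<open>0 \<le> lam\<close> by (intro H_antimono mult_left_mono) auto
        then show "gap_rate \<xi> lam V y s - gap_rate \<xi> lam V (Suc y) s \<le> 0"
          using IH[OF s] True by (simp add: gap_rate_def[of _ _ _ y])
      qed (fact t)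
      then show ?thesis by simp
    qed
    moreover from this have "0 \<le> gap_rate \<xi> lam V y t" if "t \<in> {0..T}" for t
      using H_antimono[OF mult_left_mono[OF le[OF that] \<open>0 \<le> lam\<close>]] True by (simp add: gap_rate_def)
    ultimately show ?thesis
      by simp
  qed
qed

lemma gap_mono_level:
  assumes sol: "hjb_solution \<xi> cm lam T V" and "0 \<le> lam"
    and convex: "\<And>x. x + 2 \<le> \<xi> \<Longrightarrow> cm (x + 1) - cm x \<le> cm (x + 2) - cm (x + 1)"
    and "x \<le> y" "y < \<xi>" "t \<in> {0..T}"
  shows "gap V x t \<le> gap V y t"
  using \<open>x \<le> y\<close> \<open>y < \<xi>\<close>
proof (induction rule: dec_induct)
  case (step n)
  then show ?case
    using gap_rate_nonneg_and_gap_increasing[OF sol \<open>0 \<le> lam\<close> convex, of n] \<open>t \<in> {0..T}\<close> by force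
qed simp

lemma gap_mono_time:
  assumes sol: "hjb_solution \<xi> cm lam T V" and "0 \<le> lam"
    and convex: "\<And>x. x + 2 \<le> \<xi> \<Longrightarrow> cm (x + 1) - cm x \<le> cm (x + 2) - cm (x + 1)"
    and "y < \<xi>" "0 \<le> s" "s \<le> t" "t \<le> T"
  shows "gap V y s \<le> gap V y t"
  using gap_rate_nonneg_and_gap_increasing[OF sol \<open>0 \<le> lam\<close> convex \<open>y < \<xi>\<close>] gap_deriv[OF sol \<open>y < \<xi>\<close>] assms
  by (intro nondecreasing_if_deriv_nonneg_within[of T "gap V y" "gap_rate \<xi> lam V y"]) auto

text \<open>The scaled gap is the argument of \<open>H\<close>, so this is the quantity whose order
  fixes the order of the optimal rates. If the claim failed at some moment,
  \<open>H_antimono\<close> at \<open>y\<close> and the induction hypothesis at \<open>Suc y\<close>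
  would order the two values of \<open>gap_rate\<close> the opposite way. Monotonicity of
  \<open>cm\<close> makes the initial gap nonnegative, so that scaling preserves the order at time
  \<open>0\<close>.\<close>

lemma scaled_gap_mono_rate:
  assumes sol: "hjb_solution \<xi> cm lam T V" "hjb_solution \<xi> cm lam' T V'" and "0 \<le> lam" "lam \<le> lam'"
    and convex: "\<And>x. x + 2 \<le> \<xi> \<Longrightarrow> cm (x + 1) - cm x \<le> cm (x + 2) - cm (x + 1)"
    and mono: "mono_on {..\<xi>} cm"
    and "y < \<xi>" "t \<in> {0..T}"
  shows "lam * gap V y t \<le> lam' * gap V' y t"
  using \<open>y < \<xi>\<close> \<open>t \<in> {0..T}\<close>
proof (induction "\<xi> - y" arbitrary: y t rule: less_induct)
  case less
  have "lam * gap V y t - lam' * gap V' y t \<le> 0"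
  proof (rule nonpos_if_nonincreasing_above_zero[of T "\<lambda>t. lam * gap V y t - lam' * gap V' y t"
        "\<lambda>t. lam * gap_rate \<xi> lam V y t - lam' * gap_rate \<xi> lam' V' y t"])
    have "lam * (cm (Suc y) - cm y) \<le> lam' * (cm (Suc y) - cm y)"
      using \<open>lam \<le> lam'\<close> mono_onD[OF mono, of y "Suc y"] less.prems by (intro mult_right_mono) auto
    then show "lam * gap V y 0 - lam' * gap V' y 0 \<le> 0"
      using less.prems by (simp add: hjb_solution_init[OF sol(1)] hjb_solution_init[OF sol(2)])
    fix s assume s: "s \<in> {0..T}"
    show "((\<lambda>t. lam * gap V y t - lam' * gap V' y t) has_real_derivative
        lam * gap_rate \<xi> lam V y s - lam' * gap_rate \<xi> lam' V' y s) (at s within {0..T})"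
      using gap_deriv[OF _ _ s] sol less.prems by (intro DERIV_diff DERIV_cmult) blast+
    assume "0 < lam * gap V y s - lam' * gap V' y s"
    then have "H (lam * gap V y s) \<le> H (lam' * gap V' y s)"
      by (intro H_antimono) simp
    moreover have "H (lam' * gap V' (Suc y) s) \<le> H (lam * gap V (Suc y) s)" if "Suc y < \<xi>"
      using less.hyps[of "Suc y" s] that s by (intro H_antimono) auto
    ultimately have "gap_rate \<xi> lam V y s \<le> gap_rate \<xi> lam' V' y s"
      by (auto simp: gap_rate_def)
    \<comment> \<open>Multiplying
      \<open>gap_rate \<xi> lam V y s \<le> gap_rate \<xi> lam' V' y s\<close> by
      \<open>lam \<le> lam'\<close> requires this sign; it is the monotonicity of the gap in
      time.\<close>
    moreover have "0 \<le> gap_rate \<xi> lam V y s"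
      using gap_rate_nonneg_and_gap_increasing[OF sol(1) \<open>0 \<le> lam\<close> convex less.prems(1)] s by blast
    ultimately show "lam * gap_rate \<xi> lam V y s - lam' * gap_rate \<xi> lam' V' y s \<le> 0"
      using \<open>0 \<le> lam\<close> \<open>lam \<le> lam'\<close> by (simp add: mult_mono)
  qed (fact less.prems)
  then show ?case by simp
qed

end

section \<open>The next jump under a deterministic intensity\<close>

lemma set_integrable_bounded_on_Icc:
  fixes g :: "real \<Rightarrow> real"
  assumes "g \<in> borel_measurable borel" "\<And>k. k \<in> A \<Longrightarrow> \<bar>g k\<bar> \<le> B"
    and "A \<in> sets borel" "A \<subseteq> {c..d}"
  shows "set_integrable lborel A g"
  unfolding set_integrable_def
proof (rule integrableI_bounded_set_indicator)
  have "emeasure lborel A \<le> emeasure lborel {c..d}"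
    using assms by (intro emeasure_mono) auto
  also have "\<dots> < \<infinity>"
    using emeasure_lborel_cbox_finite[of c d] by (simp add: cbox_interval)
  finally show "emeasure lborel A < \<infinity>" .
qed (use assms in auto)

lemma abs_set_integral_le_on_Icc:
  fixes g :: "real \<Rightarrow> real"
  assumes "g \<in> borel_measurable borel" "\<And>k. k \<in> A \<Longrightarrow> \<bar>g k\<bar> \<le> B"
    and "A \<in> sets borel" "A \<subseteq> {c..d}" "c \<le> d" "0 \<le> B"
  shows "\<bar>LBINT k:A. g k\<bar> \<le> B * (d - c)"
proof -
  have int: "set_integrable lborel A g" "set_integrable lborel {c..d} (\<lambda>_. B)"
    by (rule set_integrable_bounded_on_Icc[of _ _ B c d]; use assms in auto)+
  have "\<bar>LBINT k:A. g k\<bar> \<le> (LBINT k:A. \<bar>g k\<bar>)"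
    using set_integral_norm_bound[OF int(1)] by simp
  also have "\<dots> \<le> (LBINT k:{c..d}. B)"
    using set_integrable_abs[OF int(1)] int(2) assms
    unfolding set_lebesgue_integral_def set_integrable_def
    by (intro integral_mono) (auto simp: indicator_def)
  also have "\<dots> = B * (d - c)"
    using \<open>c \<le> d\<close> by (simp add: set_integral_const)
  finally show ?thesis .
qed

locale intensity =
  fixes q :: "real \<Rightarrow> real" and B a :: real
  assumes q_meas [measurable]: "q \<in> borel_measurable borel"
    and q_nonneg: "\<And>k. 0 \<le> q k" and q_le: "\<And>k. q k \<le> B"
begin

text \<open>Remaining time runs down from \<open>a\<close>, so this operational clock grows as its
  argument falls; it is \<open>0\<close> from \<open>a\<close> onwards.\<close>

definition cumulated :: "real \<Rightarrow> real" where
  "cumulated c = (LBINT j:{c..a}. q j)"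

lemma B_nonneg: "0 \<le> B"
  using q_nonneg[of 0] q_le[of 0] by simp

lemma q_abs_le: "\<bar>q k\<bar> \<le> B"
  using q_nonneg[of k] q_le[of k] by simp

lemma q_integrable: "A \<in> sets borel \<Longrightarrow> A \<subseteq> {c..d} \<Longrightarrow> set_integrable lborel A q"
  by (rule set_integrable_bounded_on_Icc[OF q_meas]) (use q_abs_le in auto)

lemma cumulated_nonneg: "0 \<le> cumulated c"
  unfolding cumulated_def set_lebesgue_integral_def using q_nonneg by (intro integral_nonneg_AE) auto

lemma cumulated_end: "cumulated a = 0"
  unfolding cumulated_def set_lebesgue_integral_def
proof (rule integral_eq_zero_AE)
  show "AE k in lborel. indicator {a..a} k *\<^sub>R q k = 0"
    using AE_lborel_singleton[of a] by eventually_elim auto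
qed

lemma cumulated_open: "cumulated c = (LBINT j:{c<..a}. q j)"
  unfolding cumulated_def set_lebesgue_integral_def
proof (rule integral_cong_AE)
  show "AE k in lborel. indicator {c..a} k *\<^sub>R q k = indicator {c<..a} k *\<^sub>R q k"
    using AE_lborel_singleton[of c] by eventually_elim (auto simp: indicator_def)
qed auto

lemma cumulated_diff:
  assumes "c \<le> d"
  shows "0 \<le> cumulated c - cumulated d" "cumulated c - cumulated d \<le> B * (d - c)"
proof -
  \<comment> \<open>The cut at \<open>a\<close> covers the case in which \<open>d\<close> lies
    beyond \<open>a\<close>.\<close>
  let ?A = "{c..<d} \<inter> {..a}"
  have "{c..a} = ?A \<union> {d..a}"
    using assms by auto
  then have "cumulated c = (LBINT j:?A \<union> {d..a}. q j)"
    by (simp only: cumulated_def)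
  also have "\<dots> = (LBINT j:?A. q j) + cumulated d"
    unfolding cumulated_def by (intro set_integral_Un q_integrable[of _ c d] q_integrable[of _ d a]) auto
  finally have "cumulated c = (LBINT j:?A. q j) + cumulated d" .
  moreover have "0 \<le> (LBINT j:?A. q j)"
    unfolding set_lebesgue_integral_def using q_nonneg by (intro integral_nonneg_AE) auto
  moreover have "\<bar>LBINT j:?A. q j\<bar> \<le> B * (d - c)"
    using assms B_nonneg q_abs_le by (intro abs_set_integral_le_on_Icc) auto
  ultimately show "0 \<le> cumulated c - cumulated d" "cumulated c - cumulated d \<le> B * (d - c)"
    by auto
qed

lemma cumulated_antimono: "c \<le> d \<Longrightarrow> cumulated d \<le> cumulated c"
  using cumulated_diff(1)[of c d] by simp

lemma cumulated_cont: "continuous_on A cumulated"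
proof -
  have "\<bar>cumulated c - cumulated d\<bar> \<le> B * \<bar>c - d\<bar>" for c d
    using cumulated_diff[of c d] cumulated_diff[of d c] by (cases "c \<le> d") auto
  then have "B-lipschitz_on A cumulated"
    using B_nonneg by (auto intro!: lipschitz_onI simp: dist_real_def)
  then show ?thesis
    by (rule lipschitz_on_continuous_on)
qed

text \<open>Since \<open>cumulated\<close> is continuous, the set in \<open>next_entry\<close> is
  closed and its supremum is attained.\<close>

lemma next_entry_cases:
  obtains (none) "next_entry q a e = -1" "\<And>k. k \<in> {0..a} \<Longrightarrow> cumulated k < e"
  | (jump) "next_entry q a e \<in> {0..a}" "e \<le> cumulated (next_entry q a e)"
      "\<And>k. k \<in> {next_entry q a e<..a} \<Longrightarrow> cumulated k < e"
proof -
  define K where "K = {k \<in> {0..a}. e \<le> cumulated k}"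
  have next_entry_K: "next_entry q a e = (if K = {} then -1 else Sup K)"
    by (simp only: next_entry_def K_def cumulated_def Let_def)
  show thesis
  proof (cases "K = {}")
    case True
    then have "cumulated k < e" if "k \<in> {0..a}" for k
      using that unfolding K_def by force
    with True show thesis
      using next_entry_K by (intro none) simp_all
  next
    case False
    have "closed K"
      unfolding K_def by (intro continuous_on_closed_Collect_le continuous_on_const cumulated_cont) auto
    moreover have bdd: "bdd_above K"
      by (auto simp: K_def intro!: bdd_aboveI[of _ a])
    ultimately have *: "Sup K \<in> K"
      using False by (intro closed_contains_Sup)
    then have "next_entry q a e \<in> {0..a}" "e \<le> cumulated (next_entry q a e)"
      using False next_entry_K by (auto simp: K_def)
    moreover have "cumulated k < e" if "k \<in> {next_entry q a e<..a}" for k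
    proof (rule ccontr)
      assume "\<not> cumulated k < e"
      then have "k \<in> K"
        using that calculation(1) by (auto simp: K_def)
      then show False
        using cSup_upper[OF _ bdd] that next_entry_K False by force
    qed
    ultimately show thesis
      using jump by blast
  qed
qed

lemma next_entry_ge: "-1 \<le> next_entry q a e"
  by (rule next_entry_cases[of e]) auto

lemma next_entry_le: "-1 \<le> a \<Longrightarrow> next_entry q a e \<le> a"
  by (rule next_entry_cases[of e]) auto

lemma next_entry_neg: "next_entry q a e < 0 \<longleftrightarrow> next_entry q a e = -1"
  by (rule next_entry_cases[of e]) auto

text \<open>\<open>next_entry\<close> is the generalized inverse of the antitone function
  \<open>cumulated\<close>. Comparing it with a threshold becomes comparing an integral with the
  clock, which serves both measurability and the rewriting of a jump as an integral of
  indicators.\<close>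

lemma le_next_entry_iff:
  assumes "0 \<le> c"
  shows "c \<le> next_entry q a e \<longleftrightarrow> c \<le> a \<and> e \<le> cumulated c"
proof (rule next_entry_cases[of e])
  assume *: "next_entry q a e \<in> {0..a}" "e \<le> cumulated (next_entry q a e)"
    "\<And>k. k \<in> {next_entry q a e<..a} \<Longrightarrow> cumulated k < e"
  show ?thesis
  proof (cases "c \<le> next_entry q a e")
    case True
    then show ?thesis
      using * cumulated_antimono[OF True] by auto
  next
    case False
    then show ?thesis
      using *(3)[of c] by auto
  qed
qed (use assms in force)

text \<open>There is no overshoot: by the intermediate value theorem the accumulated intensity
  equals \<open>e\<close> at the jump. The inner \<open>max\<close> lifts the default
  \<open>-1\<close> to \<open>0\<close>, so without a jump the accumulation runs until
  maintenance.\<close>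

lemma cumulated_next_entry:
  assumes "0 \<le> e" "j \<in> {0..a}"
  shows "cumulated (max (max 0 (next_entry q a e)) j) = min e (cumulated j)"
proof (rule next_entry_cases[of e])
  let ?T = "next_entry q a e"
  assume *: "?T \<in> {0..a}" "e \<le> cumulated ?T" "\<And>k. k \<in> {?T<..a} \<Longrightarrow> cumulated k < e"
  obtain x where x: "?T \<le> x" "x \<le> a" "cumulated x = e"
    using IVT2'[of cumulated a e ?T] * cumulated_end cumulated_cont \<open>0 \<le> e\<close> by auto
  then have "cumulated ?T = e"
    using *(3)[of x] by (cases "x = ?T") auto
  moreover have "cumulated j < e" if "\<not> j \<le> ?T"
    using *(3)[of j] that assms by simp
  ultimately show ?thesis
    using * cumulated_antimono[of j ?T] by (cases "j \<le> ?T") (auto simp: max_def min_def)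
qed (use assms in \<open>force simp: max_def min_def\<close>)

end

lemma measurable_next_entry:
  assumes [measurable]: "(\<lambda>(\<omega>, k). q \<omega> k) \<in> borel_measurable (M \<Otimes>\<^sub>M borel)"
    "a \<in> borel_measurable M" "e \<in> borel_measurable M"
    and q: "\<And>\<omega> k. 0 \<le> q \<omega> k" "\<And>\<omega> k. q \<omega> k \<le> B"
  shows "(\<lambda>\<omega>. next_entry (q \<omega>) (a \<omega>) (e \<omega>)) \<in> borel_measurable M"
  unfolding borel_measurable_iff_ge
proof
  fix c :: real
  have q_int: "intensity (q \<omega>) B" if "\<omega> \<in> space M" for \<omega>
    using q measurable_Pair2[OF assms(1) that] by (auto simp: intensity_def)
  have pos: "{\<omega> \<in> space M. c \<le> next_entry (q \<omega>) (a \<omega>) (e \<omega>)} \<in> sets M" if "0 \<le> c" for c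
  proof -
    have [measurable]: "(\<lambda>(\<omega>, k). q \<omega> k) \<in> borel_measurable (M \<Otimes>\<^sub>M lborel)"
      by (simp add: measurable_lborel2 cong: measurable_cong_sets)
    have "(\<lambda>\<omega>. LBINT j:{c..a \<omega>}. q \<omega> j) = (\<lambda>\<omega>. \<integral>j. (if c \<le> j \<and> j \<le> a \<omega> then q \<omega> j else 0) \<partial>lborel)"
      unfolding set_lebesgue_integral_def by (intro ext Bochner_Integration.integral_cong) auto
    moreover have "(\<lambda>\<omega>. \<integral>j. (if c \<le> j \<and> j \<le> a \<omega> then q \<omega> j else 0) \<partial>lborel) \<in> borel_measurable M"
      by measurable
    ultimately have [measurable]: "(\<lambda>\<omega>. LBINT j:{c..a \<omega>}. q \<omega> j) \<in> borel_measurable M"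
      by simp
    have "{\<omega> \<in> space M. c \<le> next_entry (q \<omega>) (a \<omega>) (e \<omega>)}
        = {\<omega> \<in> space M. c \<le> a \<omega> \<and> e \<omega> \<le> (LBINT j:{c..a \<omega>}. q \<omega> j)}"
      using intensity.le_next_entry_iff[OF q_int \<open>0 \<le> c\<close>] intensity.cumulated_def[OF q_int] by auto
    also have "\<dots> \<in> sets M"
      by measurable
    finally show ?thesis .
  qed
  show "{\<omega> \<in> space M. c \<le> next_entry (q \<omega>) (a \<omega>) (e \<omega>)} \<in> sets M"
  proof (cases "c \<le> -1")
    case True
    then have "{\<omega> \<in> space M. c \<le> next_entry (q \<omega>) (a \<omega>) (e \<omega>)} = space M"
      using order_trans[OF True intensity.next_entry_ge[OF q_int]] by auto
    then show ?thesis by simp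
  next
    case False
    \<comment> \<open>No value lies strictly between \<open>-1\<close> and \<open>0\<close>, so a
      threshold there acts like \<open>0\<close>.\<close>
    then have "c \<le> next_entry (q \<omega>) (a \<omega>) (e \<omega>) \<longleftrightarrow> max c 0 \<le> next_entry (q \<omega>) (a \<omega>) (e \<omega>)"
      if "\<omega> \<in> space M" for \<omega>
      using intensity.next_entry_neg[OF q_int[OF that], of "a \<omega>" "e \<omega>"] by (cases "0 \<le> c") auto
    then show ?thesis
      using pos[of "max c 0"] by (simp cong: conj_cong)
  qed
qed

section \<open>Compensation of a single jump\<close>

text \<open>The compensator of a jump at \<open>T\<close> with weight \<open>D\<close>, minus the
  jump itself. The sign fits a loss of \<open>D T\<close> at the jump, as \<open>D\<close> will be a
  gap of \<open>V\<close>. With \<open>T = -1\<close> the integral runs down to \<open>0\<close> and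
  no jump is subtracted.\<close>

definition compensated :: "(real \<Rightarrow> real) \<Rightarrow> (real \<Rightarrow> real) \<Rightarrow> real \<Rightarrow> real \<Rightarrow> real" where
  "compensated q D a T = (LBINT k:{max 0 T<..a}. q k * D k) - (if 0 \<le> T then D T else 0)"

lemma measurable_compensated:
  assumes [measurable]: "(\<lambda>(\<omega>, k). q \<omega> k) \<in> borel_measurable (M \<Otimes>\<^sub>M borel)" "D \<in> borel_measurable borel"
    "a \<in> borel_measurable M" "T \<in> borel_measurable M"
  shows "(\<lambda>\<omega>. compensated (q \<omega>) D (a \<omega>) (T \<omega>)) \<in> borel_measurable M"
proof -
  have [measurable]: "(\<lambda>(\<omega>, k). q \<omega> k) \<in> borel_measurable (M \<Otimes>\<^sub>M lborel)"
    by (simp add: measurable_lborel2 cong: measurable_cong_sets)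
  have "(\<lambda>\<omega>. LBINT k:{max 0 (T \<omega>)<..a \<omega>}. q \<omega> k * D k)
      = (\<lambda>\<omega>. \<integral>k. (if max 0 (T \<omega>) < k \<and> k \<le> a \<omega> then q \<omega> k * D k else 0) \<partial>lborel)"
    unfolding set_lebesgue_integral_def by (intro ext Bochner_Integration.integral_cong) auto
  moreover have "(\<lambda>\<omega>. \<integral>k. (if max 0 (T \<omega>) < k \<and> k \<le> a \<omega> then q \<omega> k * D k else 0) \<partial>lborel) \<in> borel_measurable M"
    by measurable
  ultimately have [measurable]: "(\<lambda>\<omega>. LBINT k:{max 0 (T \<omega>)<..a \<omega>}. q \<omega> k * D k) \<in> borel_measurable M"
    by simp
  show ?thesis
    unfolding compensated_def by measurable
qed

abbreviation clock :: "real measure" where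
  "clock \<equiv> density lborel (exponential_density 1)"

lemma prob_space_clock: "prob_space clock"
  by (rule prob_space_exponential_density) simp

lemma AE_clock_nonneg: "AE e in clock. 0 \<le> e"
  by (subst AE_density) (auto simp: exponential_density_def)

lemma AE_clock_pos: "AE e in clock. 0 < e"
proof (subst AE_density)
  show "AE e in lborel. 0 < ennreal (exponential_density 1 e) \<longrightarrow> 0 < e"
    using AE_lborel_singleton[of 0] by eventually_elim (auto simp: exponential_density_def not_less)
qed auto

text \<open>The inner \<open>max\<close> acts only on the null event \<open>e < 0\<close>, where it
  keeps the function bounded.\<close>

definition jump_surplus :: "real \<Rightarrow> real \<Rightarrow> real" where
  "jump_surplus L e = min (max 0 e) L - (if e \<le> L then 1 else 0)"

lemma jump_surplus_measurable [measurable]: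
  "(\<lambda>x. jump_surplus (L x) (e x)) \<in> borel_measurable M"
  if [measurable]: "L \<in> borel_measurable M" "e \<in> borel_measurable M"
  unfolding jump_surplus_def by measurable

lemma abs_jump_surplus_le: "0 \<le> L \<Longrightarrow> \<bar>jump_surplus L e\<bar> \<le> L + 1"
  by (auto simp: jump_surplus_def)

text \<open>
  A unit-rate Poisson process stopped at L or at its first jump has as many jumps
  as time elapsed, in the mean.
\<close>

lemma jump_surplus_mean_zero:
  assumes "0 \<le> L"
  shows "(\<integral>e. jump_surplus L e \<partial>clock) = 0"
proof -
  interpret clock: prob_space clock
    by (rule prob_space_clock)
  \<comment> \<open>For \<open>e \<ge> 0\<close> the surplus is \<open>L + h e\<close>, where
    \<open>h\<close> vanishes outside \<open>{0..L}\<close>. Its product with the exponential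
    density has the primitive \<open>(L - e) * exp (- e)\<close> there.\<close>
  define h where "h e = indicator {0..L} e * (e - 1 - L)" for e :: real
  have h_meas [measurable]: "h \<in> borel_measurable borel"
    unfolding h_def by measurable
  have h_bound: "\<bar>h e\<bar> \<le> 1 + L" for e
    using assms by (auto simp: h_def indicator_def)
  have h_int: "integrable clock h"
    using h_bound by (intro clock.integrable_const_bound[of _ "1 + L"]) auto
  have "(\<integral>e. h e \<partial>clock) = (\<integral>e. exponential_density 1 e * h e \<partial>lborel)"
    by (subst integral_density) (auto simp: exponential_density_nonneg)
  also have "\<dots> = (\<integral>e. (exp (- e) * (e - 1 - L)) * indicator {0..L} e \<partial>lborel)"
    by (intro Bochner_Integration.integral_cong) (auto simp: exponential_density_def h_def indicator_def)
  also have "\<dots> = (L - L) * exp (- L) - (L - 0) * exp (- 0)"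
  proof (rule integral_FTC_Icc_real[OF assms])
    fix e show "((\<lambda>e. (L - e) * exp (- e)) has_real_derivative exp (- e) * (e - 1 - L)) (at e)"
      by (auto intro!: derivative_eq_intros simp: algebra_simps)
  qed (auto intro!: continuous_intros)
  finally have h: "(\<integral>e. h e \<partial>clock) = - L"
    by simp
  have "(\<integral>e. jump_surplus L e \<partial>clock) = (\<integral>e. L + h e \<partial>clock)"
  proof (rule integral_cong_AE)
    show "AE e in clock. jump_surplus L e = L + h e"
      using AE_clock_nonneg by eventually_elim (auto simp: jump_surplus_def h_def indicator_def)
  qed auto
  also have "\<dots> = L + (\<integral>e. h e \<partial>clock)"
    using h_int by (simp add: clock.prob_space[simplified])
  finally show ?thesis
    using h by simp
qed

context intensity
begin

lemma cumulated_measurable [measurable]: "cumulated \<in> borel_measurable borel"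
  by (intro borel_measurable_continuous_onI cumulated_cont)

text \<open>Fubini on the region \<open>j \<le> k\<close>: for fixed \<open>j\<close>, the variable
  \<open>k\<close> ranges from \<open>max S j\<close> to \<open>a\<close>. This moves the dependence
  on the jump time \<open>S\<close> into \<open>cumulated\<close>, where
  \<open>cumulated_next_entry\<close> evaluates it.\<close>

lemma integral_by_parts_cumulated:
  assumes g [measurable]: "g \<in> borel_measurable borel" and g_bound: "\<And>k. k \<in> {0..a} \<Longrightarrow> \<bar>g k\<bar> \<le> G"
    and S: "0 \<le> S"
  shows "(LBINT k:{S<..a}. q k * (LBINT j:{0..k}. g j)) = (LBINT j:{0..a}. g j * cumulated (max S j))"
proof -
  define P where "P k j = (if S < k \<and> k \<le> a \<and> 0 \<le> j \<and> j \<le> k then q k * g j else 0)" for k j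
  have P_meas [measurable]: "case_prod P \<in> borel_measurable (lborel \<Otimes>\<^sub>M lborel)"
    unfolding P_def by measurable
  have P_int: "integrable (lborel \<Otimes>\<^sub>M lborel) (case_prod P)"
  proof (rule integrableI_bounded_set[where A = "{0..a} \<times> {0..a}" and B = "B * G"])
    show "emeasure (lborel \<Otimes>\<^sub>M lborel) ({0..a} \<times> {0..a}) < \<infinity>"
      by (subst lborel.emeasure_pair_measure_Times)
         (auto simp: ennreal_mult_less_top emeasure_lborel_Icc_eq)
    show "AE x in lborel \<Otimes>\<^sub>M lborel. x \<in> {0..a} \<times> {0..a} \<longrightarrow> norm (case_prod P x) \<le> B * G"
    proof (intro AE_I2 impI)
      fix x :: "real \<times> real" assume x: "x \<in> {0..a} \<times> {0..a}"
      have "\<bar>q (fst x)\<bar> * \<bar>g (snd x)\<bar> \<le> B * G"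
        using x by (intro mult_mono q_abs_le g_bound B_nonneg) auto
      moreover have "0 \<le> B * G"
        using calculation by (rule order_trans[rotated]) simp
      ultimately show "norm (case_prod P x) \<le> B * G"
        by (auto simp: P_def split_beta abs_mult)
    qed
    show "AE x in lborel \<Otimes>\<^sub>M lborel. x \<notin> {0..a} \<times> {0..a} \<longrightarrow> case_prod P x = 0"
      using S by (intro AE_I2) (auto simp: P_def split: if_splits)
  qed auto
  have "(LBINT k:{S<..a}. q k * (LBINT j:{0..k}. g j)) = (\<integral>k. \<integral>j. P k j \<partial>lborel \<partial>lborel)"
    unfolding set_lebesgue_integral_def
  proof (intro Bochner_Integration.integral_cong refl)
    fix k :: real
    have "(\<integral>j. P k j \<partial>lborel) = (\<integral>j. (indicator {S<..a} k * q k) * (indicator {0..k} j *\<^sub>R g j) \<partial>lborel)"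
      by (intro Bochner_Integration.integral_cong) (auto simp: P_def indicator_def)
    then show "indicator {S<..a} k *\<^sub>R (q k * (\<integral>j. indicator {0..k} j *\<^sub>R g j \<partial>lborel)) = (\<integral>j. P k j \<partial>lborel)"
      by (simp add: mult.assoc)
  qed
  also have "\<dots> = (\<integral>j. \<integral>k. P k j \<partial>lborel \<partial>lborel)"
    by (rule lborel_pair.Fubini_integral[OF P_int, symmetric])
  also have "\<dots> = (LBINT j:{0..a}. g j * cumulated (max S j))"
    unfolding set_lebesgue_integral_def
  proof (intro Bochner_Integration.integral_cong refl)
    fix j :: real
    have "(\<integral>k. P k j \<partial>lborel) = (\<integral>k. (indicator {0..a} j * g j) * (indicator {max S j..a} k *\<^sub>R q k) \<partial>lborel)"
    proof (rule integral_cong_AE)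
      show "AE k in lborel. P k j = (indicator {0..a} j * g j) * (indicator {max S j..a} k *\<^sub>R q k)"
        using AE_lborel_singleton[of S] by eventually_elim (auto simp: P_def indicator_def)
    qed (auto simp: P_def)
    also have "\<dots> = indicator {0..a} j * g j * cumulated (max S j)"
      unfolding cumulated_def set_lebesgue_integral_def by simp
    finally show "(\<integral>k. P k j \<partial>lborel) = indicator {0..a} j *\<^sub>R (g j * cumulated (max S j))"
      by simp
  qed
  finally show ?thesis .
qed

text \<open>
  By linearity in D, it suffices that the jump indicator of each interval [j, a] has
  the same mean as the intensity accumulated on it before the jump, which is jump_surplus.
\<close>

lemma compensated_mean_zero:
  assumes g [measurable]: "g \<in> borel_measurable borel" and g_bound: "\<And>k. k \<in> {0..a} \<Longrightarrow> \<bar>g k\<bar> \<le> G"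
    and D [measurable]: "D \<in> borel_measurable borel"
    and D_eq: "\<And>k. k \<in> {0..a} \<Longrightarrow> D k = D 0 + (LBINT j:{0..k}. g j)"
  shows "(\<integral>e. compensated q D a (next_entry q a e) \<partial>clock) = 0"
proof (cases "0 \<le> a")
  case False
  then have "next_entry q a e = -1" for e
    by (auto intro: next_entry_cases[of e])
  then show ?thesis
    using False by (simp add: compensated_def set_lebesgue_integral_def)
next
  case True
  interpret clock: prob_space clock
    by (rule prob_space_clock)
  interpret clock_lborel: pair_sigma_finite clock lborel ..
  have G: "0 \<le> G"
    using g_bound[of 0] True by auto
  define Q where "Q e j = indicator {0..a} j * (g j * jump_surplus (cumulated j) e)" for e j :: real
  have "(\<lambda>x. Q (fst x) (snd x)) \<in> borel_measurable (borel \<Otimes>\<^sub>M borel)"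
    unfolding Q_def by measurable
  then have Q_meas [measurable]: "case_prod Q \<in> borel_measurable (clock \<Otimes>\<^sub>M lborel)"
    by (simp add: split_beta' cong: measurable_cong_sets sets_pair_measure_cong)
  have Q_int: "integrable (clock \<Otimes>\<^sub>M lborel) (case_prod Q)"
  proof (rule integrableI_bounded_set[where A = "UNIV \<times> {0..a}" and B = "G * (cumulated 0 + 1)"])
    have "UNIV \<in> sets clock" by simp
    then show "UNIV \<times> {0..a} \<in> sets (clock \<Otimes>\<^sub>M lborel)"
      by (intro pair_measureI) auto
    show "emeasure (clock \<Otimes>\<^sub>M lborel) (UNIV \<times> {0..a}) < \<infinity>"
      using clock.emeasure_space_1
      by (subst lborel.emeasure_pair_measure_Times) (auto simp: emeasure_lborel_Icc_eq)
    show "AE x in clock \<Otimes>\<^sub>M lborel. x \<in> UNIV \<times> {0..a} \<longrightarrow> norm (case_prod Q x) \<le> G * (cumulated 0 + 1)"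
    proof (intro AE_I2 impI)
      fix x :: "real \<times> real" assume x: "x \<in> UNIV \<times> {0..a}"
      have "\<bar>jump_surplus (cumulated (snd x)) (fst x)\<bar> \<le> cumulated (snd x) + 1"
        by (intro abs_jump_surplus_le cumulated_nonneg)
      also have "\<dots> \<le> cumulated 0 + 1"
        using x by (auto intro: cumulated_antimono)
      finally have "\<bar>g (snd x)\<bar> * \<bar>jump_surplus (cumulated (snd x)) (fst x)\<bar> \<le> G * (cumulated 0 + 1)"
        using x G by (intro mult_mono g_bound) auto
      then show "norm (case_prod Q x) \<le> G * (cumulated 0 + 1)"
        using x by (auto simp: Q_def split_beta abs_mult)
    qed
    show "AE x in clock \<Otimes>\<^sub>M lborel. x \<notin> UNIV \<times> {0..a} \<longrightarrow> case_prod Q x = 0"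
      by (intro AE_I2) (auto simp: Q_def indicator_def split: if_splits)
  qed simp
  \<comment> \<open>\<open>D\<close> enters through \<open>D 0\<close> and \<open>g\<close> only.
    For each \<open>j\<close> the drift contributes \<open>min e (cumulated j)\<close> and the jump
    the indicator of \<open>e \<le> cumulated j\<close>; their difference is
    \<open>jump_surplus\<close>, whose mean is \<open>0\<close> for every \<open>j\<close>
    separately.\<close>
  have pathwise: "compensated q D a (next_entry q a e) = D 0 * jump_surplus (cumulated 0) e + (\<integral>j. Q e j \<partial>lborel)"
    if e: "0 \<le> e" for e
  proof -
    let ?T = "next_entry q a e" and ?S = "max 0 (next_entry q a e)"
    have D_diff: "D k - D 0 = (LBINT j:{0..k}. g j)" if "k \<in> {0..a}" for k
      using D_eq[OF that] by simp
    have D_bound: "\<bar>q k * (D k - D 0)\<bar> \<le> B * (G * a)" if k: "k \<in> {0..a}" for k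
    proof -
      have "\<bar>LBINT j:{0..k}. g j\<bar> \<le> G * (a - 0)"
        using k g_bound G True by (intro abs_set_integral_le_on_Icc) auto
      then have "\<bar>D k - D 0\<bar> \<le> G * a"
        using D_diff[OF k] by simp
      then show ?thesis
        unfolding abs_mult by (intro mult_mono q_abs_le B_nonneg) auto
    qed
    have "(LBINT k:{?S<..a}. q k * D k) = (LBINT k:{?S<..a}. q k * D 0 + q k * (D k - D 0))"
      by (simp add: algebra_simps)
    also have "\<dots> = (LBINT k:{?S<..a}. q k * D 0) + (LBINT k:{?S<..a}. q k * (D k - D 0))"
      using D_bound
      by (intro set_integral_add set_integrable_mult_left q_integrable[of _ 0 a]
          set_integrable_bounded_on_Icc[of _ _ "B * (G * a)" 0 a]) auto
    also have "(LBINT k:{?S<..a}. q k * D 0) = D 0 * cumulated (max ?S 0)"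
      by (simp add: cumulated_open)
    also have "(LBINT k:{?S<..a}. q k * (D k - D 0)) = (LBINT k:{?S<..a}. q k * (LBINT j:{0..k}. g j))"
      by (rule set_lebesgue_integral_cong) (auto simp: D_diff)
    also have "\<dots> = (LBINT j:{0..a}. g j * cumulated (max ?S j))"
      by (rule integral_by_parts_cumulated[OF g g_bound]) auto
    also have "\<dots> = (LBINT j:{0..a}. g j * min e (cumulated j))"
      using cumulated_next_entry[OF e] by (intro set_lebesgue_integral_cong) auto
    also have "cumulated (max ?S 0) = min e (cumulated 0)"
      using cumulated_next_entry[OF e, of 0] True by simp
    finally have drift: "(LBINT k:{?S<..a}. q k * D k)
        = D 0 * min e (cumulated 0) + (LBINT j:{0..a}. g j * min e (cumulated j))" .
    have jump: "(if 0 \<le> ?T then D ?T else 0) = D 0 * (if e \<le> cumulated 0 then 1 else 0)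
        + (LBINT j:{0..a}. g j * (if e \<le> cumulated j then 1 else 0))"
    proof (cases "0 \<le> ?T")
      case T: True
      have "(LBINT j:{0..?T}. g j) = (LBINT j:{0..a}. g j * (if e \<le> cumulated j then 1 else 0))"
        unfolding set_lebesgue_integral_def
        by (intro Bochner_Integration.integral_cong) (auto simp: indicator_def le_next_entry_iff)
      then show ?thesis
        using T next_entry_le[of e] le_next_entry_iff[of 0 e] True D_eq[of ?T] by simp
    next
      case T: False
      have "cumulated j < e" if "j \<in> {0..a}" for j
        using T le_next_entry_iff[of j e] that by force
      then have "(LBINT j:{0..a}. g j * (if e \<le> cumulated j then 1 else 0)) = (LBINT j:{0..a}. 0)"
        by (intro set_lebesgue_integral_cong) (auto simp: not_le[symmetric])
      then show ?thesis
        using T \<open>\<And>j. j \<in> {0..a} \<Longrightarrow> cumulated j < e\<close>[of 0] True by (simp add: set_lebesgue_integral_def)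
    qed
    have min_bound: "\<bar>g j * min e (cumulated j)\<bar> \<le> G * e" if "j \<in> {0..a}" for j
      unfolding abs_mult using cumulated_nonneg[of j] e g_bound[OF that] by (intro mult_mono G) auto
    have ind_bound: "\<bar>g j * (if e \<le> cumulated j then 1 else 0)\<bar> \<le> G" if "j \<in> {0..a}" for j
      using g_bound[OF that] G by auto
    have "(LBINT j:{0..a}. g j * min e (cumulated j)) - (LBINT j:{0..a}. g j * (if e \<le> cumulated j then 1 else 0))
        = (LBINT j:{0..a}. g j * min e (cumulated j) - g j * (if e \<le> cumulated j then 1 else 0))"
      using min_bound ind_bound
      by (intro set_integral_diff(2)[symmetric] set_integrable_bounded_on_Icc[of _ _ "G * e" 0 a]
          set_integrable_bounded_on_Icc[of _ _ G 0 a]) auto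
    also have "\<dots> = (\<integral>j. Q e j \<partial>lborel)"
      unfolding set_lebesgue_integral_def Q_def jump_surplus_def using e
      by (intro Bochner_Integration.integral_cong) (auto simp: algebra_simps)
    finally show ?thesis
      using e unfolding compensated_def drift jump by (simp add: jump_surplus_def algebra_simps)
  qed
  have T_meas [measurable]: "(\<lambda>e. next_entry q a e) \<in> borel_measurable borel"
    using q_nonneg q_le by (intro measurable_next_entry[where B = B]) auto
  have "(\<integral>e. compensated q D a (next_entry q a e) \<partial>clock)
      = (\<integral>e. D 0 * jump_surplus (cumulated 0) e + (\<integral>j. Q e j \<partial>lborel) \<partial>clock)"
  proof (rule integral_cong_AE)
    have "(\<lambda>e. compensated q D a (next_entry q a e)) \<in> borel_measurable borel"
      by (rule measurable_compensated) measurable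
    then show "(\<lambda>e. compensated q D a (next_entry q a e)) \<in> borel_measurable clock"
      by simp
    show "AE e in clock. compensated q D a (next_entry q a e) = D 0 * jump_surplus (cumulated 0) e + (\<integral>j. Q e j \<partial>lborel)"
      using AE_clock_nonneg by eventually_elim (rule pathwise)
  qed measurable
  also have "\<dots> = (\<integral>e. D 0 * jump_surplus (cumulated 0) e \<partial>clock) + (\<integral>e. \<integral>j. Q e j \<partial>lborel \<partial>clock)"
  proof (rule Bochner_Integration.integral_add)
    show "integrable clock (\<lambda>e. D 0 * jump_surplus (cumulated 0) e)"
      using abs_jump_surplus_le[OF cumulated_nonneg[of 0]]
      by (intro integrable_mult_right clock.integrable_const_bound[of _ "cumulated 0 + 1"]) auto
    show "integrable clock (\<lambda>e. \<integral>j. Q e j \<partial>lborel)"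
      by (rule clock_lborel.integrable_fst[OF Q_int])
  qed
  also have "(\<integral>e. \<integral>j. Q e j \<partial>lborel \<partial>clock) = (\<integral>j. \<integral>e. Q e j \<partial>clock \<partial>lborel)"
    by (rule clock_lborel.Fubini_integral[OF Q_int, symmetric])
  also have "\<dots> = 0"
    by (simp add: Q_def jump_surplus_mean_zero cumulated_nonneg)
  finally show ?thesis
    by (simp add: jump_surplus_mean_zero cumulated_nonneg)
qed

end

section \<open>The controlled process\<close>

lemma clocks_eq: "clocks = (\<Pi>\<^sub>M i\<in>UNIV. clock)"
  by (simp add: clocks_def)

lemma space_clocks [simp]: "space clocks = UNIV"
  by (simp add: clocks_eq space_PiM PiE_UNIV_domain)

lemma prob_space_clocks: "prob_space clocks"
  unfolding clocks_eq by (intro prob_space_PiM prob_space_clock)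

lemma measurable_clocks_component [measurable]: "(\<lambda>\<omega>. \<omega> i) \<in> borel_measurable clocks"
  using measurable_component_singleton[of i UNIV "\<lambda>_. clock"]
  by (simp add: clocks_eq cong: measurable_cong_sets)

text \<open>A product measure is invariant under replacing one coordinate by an independent copy.
  The inner integral plays the part of the conditional expectation given all other clocks.\<close>

lemma clocks_integral_resample:
  fixes F :: "(nat \<Rightarrow> real) \<Rightarrow> real"
  assumes "integrable clocks F"
  shows "(\<integral>\<omega>. F \<omega> \<partial>clocks) = (\<integral>\<omega>. \<integral>e. F (fun_upd \<omega> i e) \<partial>clock \<partial>clocks)"
proof -
  interpret clock: prob_space clock
    by (rule prob_space_clock)
  interpret clocks: prob_space clocks
    by (rule prob_space_clocks)
  interpret pair_sigma_finite clock clocks ..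
  have eq: "distr (clock \<Otimes>\<^sub>M clocks) clocks (\<lambda>(e, \<omega>). fun_upd \<omega> i e) = clocks"
    using distr_pair_PiM_eq_PiM[of UNIV "\<lambda>_. clock" i] prob_space_clock by (simp add: clocks_eq)
  have meas: "(\<lambda>(e, \<omega>). fun_upd \<omega> i e) \<in> clock \<Otimes>\<^sub>M clocks \<rightarrow>\<^sub>M clocks"
    unfolding split_beta' clocks_eq by (rule measurable_fun_upd[of UNIV UNIV i]) auto
  have int: "integrable (clock \<Otimes>\<^sub>M clocks) (\<lambda>(e, \<omega>). F (fun_upd \<omega> i e))"
    using integrable_distr[OF meas, of F] assms unfolding eq by (simp add: split_beta')
  have "(\<integral>\<omega>. F \<omega> \<partial>clocks) = (\<integral>\<omega>. F \<omega> \<partial>distr (clock \<Otimes>\<^sub>M clocks) clocks (\<lambda>(e, \<omega>). fun_upd \<omega> i e))"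
    by (simp add: eq)
  also have "\<dots> = (\<integral>(e, \<omega>). F (fun_upd \<omega> i e) \<partial>(clock \<Otimes>\<^sub>M clocks))"
    using assms by (subst integral_distr[OF meas]) (auto simp: split_beta')
  also have "\<dots> = (\<integral>\<omega>. \<integral>e. F (fun_upd \<omega> i e) \<partial>clock \<partial>clocks)"
    by (rule integral_snd[OF int, symmetric])
  finally show ?thesis .
qed

locale controlled_process = production +
  fixes lam :: real and u :: policy and x :: nat and t :: real
  assumes lam_nonneg: "0 \<le> lam"
    and u_meas: "\<And>x y. x \<le> y \<Longrightarrow>
      (\<lambda>(h, k). u y h k) \<in> borel_measurable ((\<Pi>\<^sub>M z\<in>{x..y}. borel) \<Otimes>\<^sub>M borel)"
    and u_range: "\<And>y h k. u y h k \<in> {0..sbar}"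
    and t_nonneg: "0 \<le> t"
begin

abbreviation hist :: "(nat \<Rightarrow> real) \<Rightarrow> nat \<Rightarrow> (nat \<Rightarrow> real)" where
  "hist \<omega> n \<equiv> history lam f u x t \<omega> n"

definition entry :: "nat \<Rightarrow> (nat \<Rightarrow> real) \<Rightarrow> real" where
  "entry n \<omega> = hist \<omega> n (x + n)"

definition rate :: "nat \<Rightarrow> (nat \<Rightarrow> real) \<Rightarrow> real \<Rightarrow> real" where
  "rate n \<omega> k = lam * f (u (x + n) (hist \<omega> n) k)"

lemma entry_0: "entry 0 \<omega> = t"
  by (simp add: entry_def)

lemma entry_Suc: "entry (Suc n) \<omega> = next_entry (rate n \<omega>) (entry n \<omega>) (\<omega> (x + n))"
  by (simp add: entry_def rate_def[abs_def] Let_def)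

lemma hist_Suc: "hist \<omega> (Suc n) = (hist \<omega> n)(x + Suc n := entry (Suc n) \<omega>)"
  by (simp add: entry_def Let_def)

lemma level_eq: "level lam f u x t \<omega> k = x + card {n. k \<le> entry (Suc n) \<omega>}"
  unfolding level_def entry_def ..

text \<open>The record up to level \<open>x + n\<close> reads only the clocks of the levels strictly
  below \<open>x + n\<close>. This is where non-anticipation of policies enters.\<close>

lemma hist_resample: "x + n \<le> i \<Longrightarrow> hist (fun_upd \<omega> i e) n = hist \<omega> n"
  by (induction n) (auto simp: Let_def)

lemma
  shows entry_resample: "entry n (fun_upd \<omega> (x + n) e) = entry n \<omega>"
    and rate_resample: "rate n (fun_upd \<omega> (x + n) e) = rate n \<omega>"
    and entry_Suc_resample: "entry (Suc n) (fun_upd \<omega> (x + n) e) = next_entry (rate n \<omega>) (entry n \<omega>) e"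
proof -
  show 1: "entry n (fun_upd \<omega> (x + n) e) = entry n \<omega>"
    by (simp add: entry_def hist_resample)
  show 2: "rate n (fun_upd \<omega> (x + n) e) = rate n \<omega>"
    by (rule ext) (simp add: rate_def hist_resample)
  show "entry (Suc n) (fun_upd \<omega> (x + n) e) = next_entry (rate n \<omega>) (entry n \<omega>) e"
    by (simp only: entry_Suc 1 2 fun_upd_same)
qed

text \<open>\<open>f\<close> and \<open>r\<close> are continuous on \<open>{0..sbar}\<close> only.
  Clamping extends them to globally continuous, hence Borel, functions without changing them at any
  rate that a policy uses.\<close>

lemma clamped_cont:
  assumes "continuous_on {0..sbar} g"
  shows "continuous_on UNIV (\<lambda>s. g (max 0 (min s sbar)))"
  using sbar_pos by (intro continuous_on_compose2[OF assms] continuous_intros) auto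

lemma measurable_control:
  assumes "continuous_on {0..sbar} g" and [measurable]: "v \<in> borel_measurable M"
    and "\<And>z. z \<in> space M \<Longrightarrow> v z \<in> {0..sbar}"
  shows "(\<lambda>z. g (v z)) \<in> borel_measurable M"
proof -
  have [measurable]: "(\<lambda>s. g (max 0 (min s sbar))) \<in> borel_measurable borel"
    by (intro borel_measurable_continuous_onI clamped_cont assms)
  have "(\<lambda>z. g (max 0 (min (v z) sbar))) \<in> borel_measurable M"
    by (rule measurable_compose[OF assms(2)]) measurable
  moreover have "max 0 (min (v z) sbar) = v z" if "z \<in> space M" for z
    using assms(3)[OF that] by auto
  ultimately show ?thesis
    by (simp cong: measurable_cong)
qed

definition max_rate :: real where
  "max_rate = lam * f sbar"

lemma rate_nonneg: "0 \<le> rate n \<omega> k"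
  unfolding rate_def by (intro mult_nonneg_nonneg lam_nonneg f_nonneg u_range)

lemma rate_le: "rate n \<omega> k \<le> max_rate"
  unfolding rate_def max_rate_def using u_range[of "x + n" "hist \<omega> n" k] sbar_pos
  by (intro mult_left_mono lam_nonneg mono_onD[OF f_mono]) auto

text \<open>Measurability of the record is a hypothesis because it is proved by an induction that
  uses this lemma: a measurable record gives a measurable rate, which gives the next entry time and
  the extended record.\<close>

lemma measurable_control_of_hist:
  assumes "(\<lambda>\<omega>. hist \<omega> n) \<in> clocks \<rightarrow>\<^sub>M (\<Pi>\<^sub>M z\<in>{x..x+n}. borel)"
  shows "(\<lambda>(\<omega>, k). u (x + n) (hist \<omega> n) k) \<in> borel_measurable (clocks \<Otimes>\<^sub>M borel)"
proof -
  have "(\<lambda>p. (hist (fst p) n, snd p)) \<in> clocks \<Otimes>\<^sub>M borel \<rightarrow>\<^sub>M (\<Pi>\<^sub>M z\<in>{x..x+n}. borel) \<Otimes>\<^sub>M borel"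
    using measurable_compose[OF measurable_fst assms] by (intro measurable_Pair) auto
  from measurable_compose[OF this u_meas[of x "x + n"]] show ?thesis
    by (simp add: split_beta')
qed

lemma measurable_rate_of_hist:
  assumes "(\<lambda>\<omega>. hist \<omega> n) \<in> clocks \<rightarrow>\<^sub>M (\<Pi>\<^sub>M z\<in>{x..x+n}. borel)"
  shows "(\<lambda>(\<omega>, k). rate n \<omega> k) \<in> borel_measurable (clocks \<Otimes>\<^sub>M borel)"
proof -
  have "(\<lambda>p. f (case p of (\<omega>, k) \<Rightarrow> u (x + n) (hist \<omega> n) k)) \<in> borel_measurable (clocks \<Otimes>\<^sub>M borel)"
    by (rule measurable_control[OF f_cont measurable_control_of_hist[OF assms]])
       (simp add: split_beta' u_range del: atLeastAtMost_iff)
  then show ?thesis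
    by (simp add: rate_def split_beta')
qed

lemma measurable_hist: "(\<lambda>\<omega>. hist \<omega> n) \<in> clocks \<rightarrow>\<^sub>M (\<Pi>\<^sub>M z\<in>{x..x+n}. borel)"
proof (induction n)
  case 0
  show ?case
    unfolding history.simps add_0_right atLeastAtMost_singleton by (rule measurable_restrict) simp
next
  case (Suc n)
  have "x + n \<in> {x..x+n}"
    by simp
  then have "(\<lambda>\<omega>. hist \<omega> n (x + n)) \<in> borel_measurable clocks"
    using measurable_compose[OF Suc.IH measurable_component_singleton] by blast
  then have "(\<lambda>\<omega>. entry (Suc n) \<omega>) \<in> borel_measurable clocks"
    unfolding entry_Suc unfolding entry_def
    by (intro measurable_next_entry[where B = max_rate] measurable_rate_of_hist Suc.IH rate_nonneg rate_le) auto
  moreover have "{x..x + Suc n} = {x..x+n} \<union> {x + Suc n}"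
    by auto
  ultimately show ?case
    unfolding hist_Suc by (intro measurable_fun_upd[OF _ Suc.IH]) auto
qed

lemma measurable_entry [measurable]: "entry n \<in> borel_measurable clocks"
proof -
  have "x + n \<in> {x..x+n}"
    by simp
  then have "(\<lambda>\<omega>. hist \<omega> n (x + n)) \<in> borel_measurable clocks"
    using measurable_compose[OF measurable_hist measurable_component_singleton] by blast
  then show ?thesis
    by (simp add: entry_def[abs_def])
qed

lemmas measurable_rate [measurable] = measurable_rate_of_hist[OF measurable_hist]

lemma intensity_rate: "intensity (rate n \<omega>) max_rate"
  using measurable_Pair2[OF measurable_rate, of \<omega> n] rate_nonneg rate_le
  by (simp add: intensity_def)

lemma entry_ge: "-1 \<le> entry n \<omega>"
  using t_nonneg intensity.next_entry_ge[OF intensity_rate] by (cases n) (auto simp: entry_0 entry_Suc)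

lemma entry_Suc_le: "entry (Suc n) \<omega> \<le> entry n \<omega>"
  unfolding entry_Suc by (intro intensity.next_entry_le[OF intensity_rate] entry_ge)

lemma entry_antimono: "m \<le> n \<Longrightarrow> entry n \<omega> \<le> entry m \<omega>"
  by (rule lift_Suc_antimono_le[of "\<lambda>n. entry n \<omega>"]) (rule entry_Suc_le)

lemma entry_le: "entry n \<omega> \<le> t"
  using entry_antimono[of 0 n \<omega>] by (simp add: entry_0)

lemma entry_neg: "entry n \<omega> < 0 \<longleftrightarrow> entry n \<omega> = -1"
  using t_nonneg intensity.next_entry_neg[OF intensity_rate] by (cases n) (auto simp: entry_0 entry_Suc)

lemma level_between:
  assumes "entry (Suc n) \<omega> < k" "k \<le> entry n \<omega>"
  shows "level lam f u x t \<omega> k = x + n"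
proof -
  have "{m. k \<le> entry (Suc m) \<omega>} = {..<n}"
  proof (intro set_eqI iffI; clarsimp)
    fix m assume "k \<le> entry (Suc m) \<omega>"
    then show "m < n"
      using entry_antimono[of "Suc n" "Suc m" \<omega>] assms(1) by (meson leD le_less_trans not_less Suc_le_mono order_trans)
  next
    fix m assume "m < n"
    then show "k \<le> entry (Suc m) \<omega>"
      using entry_antimono[of "Suc m" n \<omega>] assms(2) by simp
  qed
  then show ?thesis
    by (simp add: level_eq)
qed

lemma measurable_level:
  "(\<lambda>(\<omega>, k). level lam f u x t \<omega> k) \<in> clocks \<Otimes>\<^sub>M borel \<rightarrow>\<^sub>M count_space UNIV"
proof -
  have "(\<lambda>p. card {n. snd p \<le> entry (Suc n) (fst p)}) \<in> clocks \<Otimes>\<^sub>M borel \<rightarrow>\<^sub>M count_space UNIV"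
    by (rule measurable_card) simp
  then show ?thesis
    unfolding level_eq split_beta' by measurable
qed

lemma production_rate_eq:
  "production_rate lam f u x t \<omega> k =
    (let n = card {n. k \<le> entry (Suc n) \<omega>} in u (x + n) (hist \<omega> n) k)"
  by (simp add: production_rate_def level_eq Let_def)

lemma production_rate_range: "production_rate lam f u x t \<omega> k \<in> {0..sbar}"
  unfolding production_rate_eq Let_def by (rule u_range)

lemma measurable_production_rate:
  "(\<lambda>(\<omega>, k). production_rate lam f u x t \<omega> k) \<in> borel_measurable (clocks \<Otimes>\<^sub>M borel)"
proof -
  have "(\<lambda>p. card {n. snd p \<le> entry (Suc n) (fst p)}) \<in> clocks \<Otimes>\<^sub>M borel \<rightarrow>\<^sub>M count_space UNIV"
    by (rule measurable_card) simp
  then have "(\<lambda>p. case p of (\<omega>, k) \<Rightarrow>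
      u (x + card {n. snd p \<le> entry (Suc n) (fst p)}) (hist \<omega> (card {n. snd p \<le> entry (Suc n) (fst p)})) k)
      \<in> borel_measurable (clocks \<Otimes>\<^sub>M borel)"
    by (rule measurable_compose_countable[OF measurable_control_of_hist[OF measurable_hist]])
  then show ?thesis
    by (simp add: production_rate_eq Let_def split_beta')
qed

lemma abs_compensated_le:
  assumes [measurable]: "D \<in> borel_measurable borel" and D_bound: "\<And>k. k \<in> {0..t} \<Longrightarrow> \<bar>D k\<bar> \<le> C"
  shows "\<bar>compensated (rate n \<omega>) D (entry n \<omega>) (entry (Suc n) \<omega>)\<bar> \<le> max_rate * C * t + C"
proof -
  interpret intensity "rate n \<omega>" max_rate
    by (rule intensity_rate)
  have C: "0 \<le> C"
    using D_bound[of 0] t_nonneg by auto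
  have "\<bar>LBINT k:{max 0 (entry (Suc n) \<omega>)<..entry n \<omega>}. rate n \<omega> k * D k\<bar> \<le> max_rate * C * (t - 0)"
  proof (rule abs_set_integral_le_on_Icc)
    fix k assume "k \<in> {max 0 (entry (Suc n) \<omega>)<..entry n \<omega>}"
    then show "\<bar>rate n \<omega> k * D k\<bar> \<le> max_rate * C"
      unfolding abs_mult using entry_le[of n \<omega>] by (intro mult_mono q_abs_le D_bound B_nonneg) auto
  qed (use t_nonneg C B_nonneg entry_le[of n \<omega>] in auto)
  moreover have "\<bar>if 0 \<le> entry (Suc n) \<omega> then D (entry (Suc n) \<omega>) else 0\<bar> \<le> C"
    using D_bound[of "entry (Suc n) \<omega>"] entry_le[of "Suc n" \<omega>] C by auto
  ultimately have "\<bar>LBINT k:{max 0 (entry (Suc n) \<omega>)<..entry n \<omega>}. rate n \<omega> k * D k\<bar>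
      + \<bar>if 0 \<le> entry (Suc n) \<omega> then D (entry (Suc n) \<omega>) else 0\<bar> \<le> max_rate * C * (t - 0) + C"
    by (rule add_mono)
  then show ?thesis
    unfolding compensated_def diff_0_right by (rule order_trans[OF abs_triangle_ineq4])
qed

lemma measurable_compensated_entry [measurable]:
  "(\<lambda>\<omega>. compensated (rate n \<omega>) D (entry n \<omega>) (entry (Suc n) \<omega>)) \<in> borel_measurable clocks"
  if [measurable]: "D \<in> borel_measurable borel"
  by (intro measurable_compensated) measurable

lemma integrable_compensated_entry:
  assumes [measurable]: "D \<in> borel_measurable borel" and D_bound: "\<And>k. k \<in> {0..t} \<Longrightarrow> \<bar>D k\<bar> \<le> C"
  shows "integrable clocks (\<lambda>\<omega>. compensated (rate n \<omega>) D (entry n \<omega>) (entry (Suc n) \<omega>))"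
proof -
  interpret clocks: prob_space clocks
    by (rule prob_space_clocks)
  show ?thesis
    using abs_compensated_le[OF assms]
    by (intro clocks.integrable_const_bound[of _ "max_rate * C * t + C"]) auto
qed

text \<open>The history up to level x + n does not involve the clock of that level.\<close>

lemma compensated_entry_mean_zero:
  assumes g: "g \<in> borel_measurable borel" "\<And>k. k \<in> {0..t} \<Longrightarrow> \<bar>g k\<bar> \<le> G"
    and D: "D \<in> borel_measurable borel" "\<And>k. k \<in> {0..t} \<Longrightarrow> \<bar>D k\<bar> \<le> C"
    and D_eq: "\<And>k. k \<in> {0..t} \<Longrightarrow> D k = D 0 + (LBINT j:{0..k}. g j)"
  shows "(\<integral>\<omega>. compensated (rate n \<omega>) D (entry n \<omega>) (entry (Suc n) \<omega>) \<partial>clocks) = 0"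
proof -
  have int: "integrable clocks (\<lambda>\<omega>. compensated (rate n \<omega>) D (entry n \<omega>) (entry (Suc n) \<omega>))"
    by (rule integrable_compensated_entry[OF D])
  have "(\<integral>\<omega>. compensated (rate n \<omega>) D (entry n \<omega>) (entry (Suc n) \<omega>) \<partial>clocks)
      = (\<integral>\<omega>. \<integral>e. compensated (rate n \<omega>) D (entry n \<omega>) (next_entry (rate n \<omega>) (entry n \<omega>) e) \<partial>clock \<partial>clocks)"
    using clocks_integral_resample[OF int, where i = "x + n"]
    unfolding entry_resample rate_resample entry_Suc_resample .
  also have "\<dots> = (\<integral>\<omega>. 0 \<partial>clocks)"
  proof (intro Bochner_Integration.integral_cong refl)
    fix \<omega>
    show "(\<integral>e. compensated (rate n \<omega>) D (entry n \<omega>) (next_entry (rate n \<omega>) (entry n \<omega>) e) \<partial>clock) = 0"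
    proof (rule intensity.compensated_mean_zero[OF intensity_rate g(1) _ D(1)])
      fix k assume "k \<in> {0..entry n \<omega>}"
      then have k: "k \<in> {0..t}"
        using entry_le[of n \<omega>] by auto
      show "\<bar>g k\<bar> \<le> G" "D k = D 0 + (LBINT j:{0..k}. g j)"
        by (rule g(2)[OF k], rule D_eq[OF k])
    qed
  qed
  finally show ?thesis by simp
qed

text \<open>With rate \<open>0\<close> no intensity accumulates, so a jump would require a clock
  value of at most \<open>0\<close>; this null event is the only exception.\<close>

lemma AE_entry_after_shutdown:
  assumes "\<And>h k. u (x + n) h k = 0"
  shows "AE \<omega> in clocks. entry (Suc n) \<omega> = -1"
proof -
  have "AE \<omega> in clocks. 0 < \<omega> (x + n)"
    unfolding clocks_eq by (rule AE_PiM_component) (auto intro: prob_space_clock AE_clock_pos)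
  then show ?thesis
  proof eventually_elim
    case (elim \<omega>)
    have "rate n \<omega> = (\<lambda>k. 0)"
      using assms by (simp add: rate_def[abs_def] f_0)
    then have "intensity.cumulated (rate n \<omega>) (entry n \<omega>) 0 = 0"
      unfolding intensity.cumulated_def[OF intensity_rate] by (simp add: set_lebesgue_integral_def)
    then have "\<not> 0 \<le> entry (Suc n) \<omega>"
      using elim intensity.le_next_entry_iff[OF intensity_rate, of 0 n \<omega> "entry n \<omega>" "\<omega> (x + n)"]
      by (simp add: entry_Suc)
    then show ?case
      using entry_neg[of "Suc n" \<omega>] by simp
  qed
qed

lemma level_le_after_shutdown:
  assumes "entry (Suc n) \<omega> = -1" "0 \<le> k"
  shows "level lam f u x t \<omega> k \<le> x + n"
proof -
  have "{m. k \<le> entry (Suc m) \<omega>} \<subseteq> {..<n}"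
  proof
    fix m assume "m \<in> {m. k \<le> entry (Suc m) \<omega>}"
    then show "m \<in> {..<n}"
      using entry_antimono[of "Suc n" "Suc m" \<omega>] assms by (cases "n \<le> m") auto
  qed
  then have "card {m. k \<le> entry (Suc m) \<omega>} \<le> n"
    using card_mono[of "{..<n}"] by fastforce
  then show ?thesis
    by (simp add: level_eq)
qed

lemma AE_level_le_failure:
  assumes "x \<le> \<xi>" "\<And>h k. u \<xi> h k = 0"
  shows "AE \<omega> in clocks. \<forall>k\<in>{0..t}. level lam f u x t \<omega> k \<le> \<xi>"
proof -
  have "AE \<omega> in clocks. entry (Suc (\<xi> - x)) \<omega> = -1"
    using assms by (intro AE_entry_after_shutdown) simp
  then show ?thesis
  proof eventually_elim
    case (elim \<omega>)
    then show ?case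
      using level_le_after_shutdown[OF elim] assms(1) by auto
  qed
qed

end

section \<open>Verification of the optimality equation\<close>

locale controlled_value = controlled_process +
  fixes \<xi> :: nat and cm :: "nat \<Rightarrow> real" and V :: "nat \<Rightarrow> real \<Rightarrow> real"
  assumes sol: "hjb_solution \<xi> cm lam t V"
    and x_le: "x \<le> \<xi>" and u_failed: "\<And>h k. u \<xi> h k = 0"
begin

definition V_rate :: "nat \<Rightarrow> real \<Rightarrow> real" where
  "V_rate y k = (if y < \<xi> then H (lam * gap V y k) else r 0)"

lemma V_measurable [measurable]: "V y \<in> borel_measurable borel"
  by (intro borel_measurable_continuous_onI hjb_solution_cont[OF sol])

lemma V_rate_cont: "continuous_on UNIV (V_rate y)"
  unfolding V_rate_def using hjb_solution_cont[OF sol]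
  by (cases "y < \<xi>") (auto intro!: continuous_on_compose2[OF H_cont] continuous_intros)

lemma V_rate_measurable [measurable]: "V_rate y \<in> borel_measurable borel"
  by (intro borel_measurable_continuous_onI V_rate_cont)

lemma bounded_on_horizon:
  fixes g :: "real \<Rightarrow> real"
  assumes "continuous_on UNIV g"
  shows "\<exists>C. \<forall>k\<in>{0..t}. \<bar>g k\<bar> \<le> C"
proof -
  have "bounded (g ` {0..t})"
    by (intro compact_imp_bounded compact_continuous_image continuous_on_subset[OF assms]) auto
  then show ?thesis
    by (simp add: bounded_iff)
qed

lemma V_deriv:
  assumes "k \<in> {0..t}"
  shows "(V y has_real_derivative V_rate y k) (at k within {0..t})"
proof (cases "y < \<xi>")
  case True
  then show ?thesis
    using hjb_solution_deriv[OF sol True assms] by (simp add: V_rate_def)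
next
  case False
  then have "V y = V \<xi>"
    using hjb_solution_beyond[OF sol, of y] by simp
  then show ?thesis
    using hjb_solution_deriv_failed[OF sol assms] False by (simp add: V_rate_def)
qed

lemma V_increment:
  assumes "0 \<le> c" "c \<le> d" "d \<le> t"
  shows "(LBINT k:{c<..d}. V_rate y k) = V y d - V y c"
proof -
  have "(LBINT k:{c<..d}. V_rate y k) = (LBINT k:{c..d}. V_rate y k)"
    unfolding set_lebesgue_integral_def
  proof (rule integral_cong_AE)
    show "AE k in lborel. indicator {c<..d} k *\<^sub>R V_rate y k = indicator {c..d} k *\<^sub>R V_rate y k"
      using AE_lborel_singleton[of c] by eventually_elim (auto simp: indicator_def)
  qed auto
  also have "\<dots> = V y d - V y c"
    unfolding set_lebesgue_integral_def
  proof (rule integral_FTC_atLeastAtMost[OF \<open>c \<le> d\<close>])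
    fix k assume k: "c \<le> k" "k \<le> d"
    have "(V y has_real_derivative V_rate y k) (at k within {c..d})"
      by (rule DERIV_subset[OF V_deriv]) (use k assms in auto)
    then show "(V y has_vector_derivative V_rate y k) (at k within {c..d})"
      by (simp add: has_real_derivative_iff_has_vector_derivative)
  qed (rule continuous_on_subset[OF V_rate_cont subset_UNIV])
  finally show ?thesis .
qed

lemma gap_eq_integral:
  assumes k: "k \<in> {0..t}"
  shows "gap V y k = gap V y 0 + (LBINT j:{0..k}. V_rate y j - V_rate (Suc y) j)"
proof -
  have "(LBINT j:{0..k}. V_rate y j - V_rate (Suc y) j) = gap V y k - gap V y 0"
    unfolding set_lebesgue_integral_def
  proof (rule integral_FTC_atLeastAtMost)
    fix j assume j: "0 \<le> j" "j \<le> k"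
    have "(gap V y has_real_derivative V_rate y j - V_rate (Suc y) j) (at j within {0..k})"
      by (rule DERIV_subset[OF DERIV_diff[OF V_deriv V_deriv]]) (use j k in auto)
    then show "(gap V y has_vector_derivative V_rate y j - V_rate (Suc y) j) (at j within {0..k})"
      by (simp add: has_real_derivative_iff_has_vector_derivative)
  qed (use k in \<open>auto intro!: continuous_intros continuous_on_subset[OF V_rate_cont]\<close>)
  then show ?thesis by simp
qed

text \<open>The martingale increment of the jump from \<open>x + n\<close> to
  \<open>x + n + 1\<close>, at which the value drops by \<open>gap V (x + n)\<close>.\<close>

definition increment :: "nat \<Rightarrow> (nat \<Rightarrow> real) \<Rightarrow> real" where
  "increment n \<omega> = compensated (rate n \<omega>) (gap V (x + n)) (entry n \<omega>) (entry (Suc n) \<omega>)"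

lemma increment_measurable [measurable]: "increment n \<in> borel_measurable clocks"
  unfolding increment_def[abs_def] by measurable

lemma increment_integrable: "integrable clocks (increment n)"
  and increment_mean_zero: "(\<integral>\<omega>. increment n \<omega> \<partial>clocks) = 0"
proof -
  have cont: "continuous_on UNIV (gap V (x + n))"
    "continuous_on UNIV (\<lambda>j. V_rate (x + n) j - V_rate (Suc (x + n)) j)"
    by (intro continuous_intros hjb_solution_cont[OF sol] V_rate_cont)+
  obtain C where C: "\<And>k. k \<in> {0..t} \<Longrightarrow> \<bar>gap V (x + n) k\<bar> \<le> C"
    using bounded_on_horizon[OF cont(1)] by blast
  obtain G where G: "\<And>k. k \<in> {0..t} \<Longrightarrow> \<bar>V_rate (x + n) k - V_rate (Suc (x + n)) k\<bar> \<le> G"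
    using bounded_on_horizon[OF cont(2)] by blast
  show "integrable clocks (increment n)"
    unfolding increment_def[abs_def] by (rule integrable_compensated_entry[OF _ C]) measurable
  show "(\<integral>\<omega>. increment n \<omega> \<partial>clocks) = 0"
    unfolding increment_def
    by (rule compensated_entry_mean_zero[OF _ G _ C gap_eq_integral]) measurable
qed

text \<open>The running reward under which the given policy earns exactly V.\<close>

definition fair_reward :: "(nat \<Rightarrow> real) \<Rightarrow> real \<Rightarrow> real" where
  "fair_reward \<omega> k = (let y = level lam f u x t \<omega> k in
     V_rate y k + lam * f (production_rate lam f u x t \<omega> k) * gap V y k)"

lemma fair_reward_between:
  assumes "entry (Suc n) \<omega> < k" "k \<le> entry n \<omega>"
  shows "fair_reward \<omega> k = V_rate (x + n) k + rate n \<omega> k * gap V (x + n) k"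
  using level_between[OF assms] by (simp add: fair_reward_def rate_def production_rate_def Let_def)

lemma rate_gap_integrable:
  "set_integrable lborel {c<..d} (\<lambda>k. rate n \<omega> k * gap V y k)" if "0 \<le> c" "d \<le> t"
proof -
  interpret intensity "rate n \<omega>" max_rate
    by (rule intensity_rate)
  have "continuous_on UNIV (gap V y)"
    by (intro continuous_intros hjb_solution_cont[OF sol])
  then obtain C where C: "\<And>k. k \<in> {0..t} \<Longrightarrow> \<bar>gap V y k\<bar> \<le> C"
    using bounded_on_horizon by blast
  show ?thesis
  proof (rule set_integrable_bounded_on_Icc[of _ _ "max_rate * C" 0 t])
    fix k assume "k \<in> {c<..d}"
    then show "\<bar>rate n \<omega> k * gap V y k\<bar> \<le> max_rate * C"
      unfolding abs_mult using that by (intro mult_mono q_abs_le C B_nonneg) auto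
  qed (use that in auto)
qed

lemma V_rate_integrable: "set_integrable lborel {c<..d} (V_rate y)"
  by (rule set_integrable_subset[of _ "{c..d}"])
     (auto intro!: borel_integrable_atLeastAtMost' continuous_on_subset[OF V_rate_cont])

lemma fair_reward_integral_between:
  assumes "0 \<le> entry n \<omega>" "c = max 0 (entry (Suc n) \<omega>)"
  shows "set_integrable lborel {c<..entry n \<omega>} (fair_reward \<omega>)"
    and "(LBINT k:{c<..entry n \<omega>}. fair_reward \<omega> k)
      = V (x + n) (entry n \<omega>) - V (x + n) c + (LBINT k:{c<..entry n \<omega>}. rate n \<omega> k * gap V (x + n) k)"
proof -
  have c: "0 \<le> c" "c \<le> entry n \<omega>" "entry n \<omega> \<le> t"
    using assms entry_Suc_le[of n \<omega>] entry_le[of n \<omega>] by auto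
  have eq: "fair_reward \<omega> k = V_rate (x + n) k + rate n \<omega> k * gap V (x + n) k" if "k \<in> {c<..entry n \<omega>}" for k
    using that assms by (intro fair_reward_between) auto
  have int: "set_integrable lborel {c<..entry n \<omega>} (\<lambda>k. V_rate (x + n) k + rate n \<omega> k * gap V (x + n) k)"
    by (intro set_integral_add V_rate_integrable rate_gap_integrable c)
  then show "set_integrable lborel {c<..entry n \<omega>} (fair_reward \<omega>)"
    using eq by (subst set_integrable_cong[OF refl]) auto
  have "(LBINT k:{c<..entry n \<omega>}. fair_reward \<omega> k)
      = (LBINT k:{c<..entry n \<omega>}. V_rate (x + n) k + rate n \<omega> k * gap V (x + n) k)"
    using eq by (intro set_lebesgue_integral_cong) auto
  also have "\<dots> = V (x + n) (entry n \<omega>) - V (x + n) c + (LBINT k:{c<..entry n \<omega>}. rate n \<omega> k * gap V (x + n) k)"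
    using V_increment[OF c] by (simp add: V_rate_integrable rate_gap_integrable[OF c(1,3)])
  finally show "(LBINT k:{c<..entry n \<omega>}. fair_reward \<omega> k)
      = V (x + n) (entry n \<omega>) - V (x + n) c + (LBINT k:{c<..entry n \<omega>}. rate n \<omega> k * gap V (x + n) k)" .
qed

lemma fair_reward_split:
  assumes "0 \<le> entry n \<omega>" "c = max 0 (entry (Suc n) \<omega>)"
    and int: "set_integrable lborel {entry n \<omega><..t} (fair_reward \<omega>)"
  shows "set_integrable lborel {c<..t} (fair_reward \<omega>)"
    and "(LBINT k:{c<..t}. fair_reward \<omega> k)
      = (LBINT k:{c<..entry n \<omega>}. fair_reward \<omega> k) + (LBINT k:{entry n \<omega><..t}. fair_reward \<omega> k)"
proof -
  have "c \<le> entry n \<omega>" "entry n \<omega> \<le> t"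
    using assms entry_Suc_le[of n \<omega>] entry_le[of n \<omega>] by auto
  then have Un: "{c<..t} = {c<..entry n \<omega>} \<union> {entry n \<omega><..t}"
    by auto
  show "set_integrable lborel {c<..t} (fair_reward \<omega>)"
    unfolding Un by (intro set_integrable_Un fair_reward_integral_between assms) auto
  show "(LBINT k:{c<..t}. fair_reward \<omega> k)
      = (LBINT k:{c<..entry n \<omega>}. fair_reward \<omega> k) + (LBINT k:{entry n \<omega><..t}. fair_reward \<omega> k)"
    unfolding Un by (intro set_integral_Un fair_reward_integral_between assms) auto
qed

text \<open>While level \<open>x + n\<close> is held, \<open>V (x + n)\<close> changes by the
  integral of \<open>V_rate\<close>, and the jump lowers the value by the gap; adding this up over
  levels telescopes path by path. The second branch is the state after the last jump, where the sum
  no longer changes and the value is taken at maintenance.\<close>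

lemma fair_reward_telescopes:
  "if 0 \<le> entry n \<omega>
   then set_integrable lborel {entry n \<omega><..t} (fair_reward \<omega>) \<and>
     V x t + (\<Sum>m<n. increment m \<omega>)
       = (LBINT k:{entry n \<omega><..t}. fair_reward \<omega> k) + V (x + n) (entry n \<omega>)
   else set_integrable lborel {0<..t} (fair_reward \<omega>) \<and>
     V x t + (\<Sum>m<n. increment m \<omega>)
       = (LBINT k:{0<..t}. fair_reward \<omega> k) + V (level lam f u x t \<omega> 0) 0"
proof (induction n)
  case 0
  then show ?case
    using t_nonneg by (simp add: entry_0 set_integrable_def set_lebesgue_integral_def)
next
  case (Suc n)
  show ?case
  proof (cases "0 \<le> entry n \<omega>")
    case False
    then have "entry n \<omega> = -1" "entry (Suc n) \<omega> = -1"
      using entry_neg[of n \<omega>] entry_neg[of "Suc n" \<omega>] entry_Suc_le[of n \<omega>] by auto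
    \<comment> \<open>The default \<open>-1\<close> propagates, so the interval of integration is
      empty and there is no jump to subtract.\<close>
    moreover from this have "increment n \<omega> = 0"
      by (simp add: increment_def compensated_def set_lebesgue_integral_def)
    ultimately show ?thesis
      using Suc.IH by simp
  next
    case True
    define c where "c = max 0 (entry (Suc n) \<omega>)"
    have IH: "set_integrable lborel {entry n \<omega><..t} (fair_reward \<omega>)"
      "V x t + (\<Sum>m<n. increment m \<omega>) = (LBINT k:{entry n \<omega><..t}. fair_reward \<omega> k) + V (x + n) (entry n \<omega>)"
      using Suc.IH True by auto
    note int = fair_reward_split(1)[OF True c_def IH(1)]
    have "V x t + (\<Sum>m<Suc n. increment m \<omega>)
        = (LBINT k:{entry n \<omega><..t}. fair_reward \<omega> k) + V (x + n) (entry n \<omega>) + increment n \<omega>"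
      using IH(2) by simp
    also have "\<dots> = (LBINT k:{c<..t}. fair_reward \<omega> k) + V (x + n) c
        - (if 0 \<le> entry (Suc n) \<omega> then gap V (x + n) (entry (Suc n) \<omega>) else 0)"
      using fair_reward_split(2)[OF True c_def IH(1)] fair_reward_integral_between(2)[OF True c_def]
      by (simp add: increment_def compensated_def flip: c_def)
    finally have sum: "V x t + (\<Sum>m<Suc n. increment m \<omega>) = (LBINT k:{c<..t}. fair_reward \<omega> k) + V (x + n) c
        - (if 0 \<le> entry (Suc n) \<omega> then gap V (x + n) (entry (Suc n) \<omega>) else 0)" .
    show ?thesis
    proof (cases "0 \<le> entry (Suc n) \<omega>")
      case True
      \<comment> \<open>After a jump, \<open>V (x + n) c - gap V (x + n) c\<close> is the value of
        the new level at its entry time \<open>c\<close>.\<close>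
      then show ?thesis
        using sum int by (simp add: c_def)
    next
      case no_jump: False
      then have "level lam f u x t \<omega> 0 = x + n"
        using True by (intro level_between) auto
      then show ?thesis
        using sum int no_jump by (simp add: c_def max_def)
    qed
  qed
qed

lemma AE_failed: "AE \<omega> in clocks. entry (Suc (\<xi> - x)) \<omega> = -1"
  using u_failed x_le by (intro AE_entry_after_shutdown) simp

lemmas AE_level_le = AE_level_le_failure[OF x_le u_failed]

text \<open>This is \<open>H_upper\<close> with the intensity term moved to the other side. At the
  failure level the rate is \<open>0\<close>, so that \<open>f 0 = 0\<close> removes this term and
  equality holds.\<close>

lemma reward_le_fair:
  assumes "level lam f u x t \<omega> k \<le> \<xi>"
  shows "r (production_rate lam f u x t \<omega> k) \<le> fair_reward \<omega> k"
proof (cases "level lam f u x t \<omega> k < \<xi>")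
  case True
  then show ?thesis
    using H_upper[OF production_rate_range[of \<omega> k], of "lam * gap V (level lam f u x t \<omega> k) k"]
    by (simp add: fair_reward_def V_rate_def Let_def mult_ac)
next
  case False
  then have "level lam f u x t \<omega> k = \<xi>"
    using assms by simp
  then show ?thesis
    using u_failed f_0 by (simp add: fair_reward_def V_rate_def production_rate_def)
qed

lemma reward_eq_fair:
  assumes optimal: "\<And>y h k. y < \<xi> \<Longrightarrow> u y h k \<in> maximizers (lam * gap V y k)"
    and "level lam f u x t \<omega> k \<le> \<xi>"
  shows "r (production_rate lam f u x t \<omega> k) = fair_reward \<omega> k"
proof (cases "level lam f u x t \<omega> k < \<xi>")
  case True
  then show ?thesis
    using optimal[OF True, of "hist \<omega> (level lam f u x t \<omega> k - x)" k] by (simp add: fair_reward_def V_rate_def production_rate_def maximizers_def Let_def mult_ac)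
next
  case False
  then have "level lam f u x t \<omega> k = \<xi>"
    using assms by simp
  then show ?thesis
    using u_failed f_0 by (simp add: fair_reward_def V_rate_def production_rate_def)
qed

definition payoff :: "(nat \<Rightarrow> real) \<Rightarrow> real" where
  "payoff \<omega> = (LBINT k:{0..t}. r (production_rate lam f u x t \<omega> k)) - cm (level lam f u x t \<omega> 0)"

lemma reward_measurable [measurable]:
  "(\<lambda>(\<omega>, k). r (production_rate lam f u x t \<omega> k)) \<in> borel_measurable (clocks \<Otimes>\<^sub>M borel)"
proof -
  have "(\<lambda>p. r (case p of (\<omega>, k) \<Rightarrow> production_rate lam f u x t \<omega> k)) \<in> borel_measurable (clocks \<Otimes>\<^sub>M borel)"
    by (rule measurable_control[OF r_cont measurable_production_rate])
       (simp add: split_beta' production_rate_range del: atLeastAtMost_iff)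
  then show ?thesis
    by (simp add: split_beta')
qed

lemma reward_bound: obtains C where "0 \<le> C" "\<forall>\<omega> k. \<bar>r (production_rate lam f u x t \<omega> k)\<bar> \<le> C"
proof -
  have "bounded (r ` {0..sbar})"
    by (intro compact_imp_bounded compact_continuous_image r_cont) auto
  then obtain C where C: "\<forall>s\<in>{0..sbar}. \<bar>r s\<bar> \<le> C"
    by (auto simp: bounded_iff)
  then have "0 \<le> C"
    using sbar_pos by (meson abs_ge_zero atLeastAtMost_iff less_imp_le order_refl order_trans)
  moreover have "\<forall>\<omega> k. \<bar>r (production_rate lam f u x t \<omega> k)\<bar> \<le> C"
    using C production_rate_range by blast
  ultimately show thesis
    by (rule that)
qed

lemma payoff_measurable: "payoff \<in> borel_measurable clocks"
proof -
  have [measurable]: "(\<lambda>(\<omega>, k). r (production_rate lam f u x t \<omega> k)) \<in> borel_measurable (clocks \<Otimes>\<^sub>M lborel)"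
    using reward_measurable by (simp cong: measurable_cong_sets)
  have "(\<lambda>\<omega>. LBINT k:{0..t}. r (production_rate lam f u x t \<omega> k)) \<in> borel_measurable clocks"
    unfolding set_lebesgue_integral_def by measurable
  moreover have "(\<lambda>\<omega>. level lam f u x t \<omega> 0) \<in> clocks \<rightarrow>\<^sub>M count_space UNIV"
    using measurable_compose[OF measurable_Pair measurable_level, of "\<lambda>\<omega>. \<omega>" clocks "\<lambda>_. 0"] by simp
  then have "(\<lambda>\<omega>. cm (level lam f u x t \<omega> 0)) \<in> borel_measurable clocks"
    by (rule measurable_compose) simp
  ultimately show ?thesis
    unfolding payoff_def[abs_def] by measurable
qed

lemma reward_integrable:
  "set_integrable lborel {0<..t} (\<lambda>k. r (production_rate lam f u x t \<omega> k))"
proof -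
  obtain C where C: "0 \<le> C" "\<And>\<omega> k. \<bar>r (production_rate lam f u x t \<omega> k)\<bar> \<le> C"
    using reward_bound by blast
  have "(\<lambda>k. r (production_rate lam f u x t \<omega> k)) \<in> borel_measurable borel"
    using measurable_Pair2[OF reward_measurable, of \<omega>] by simp
  then show ?thesis
    using C(2) by (rule set_integrable_bounded_on_Icc[of _ _ C 0 t]) auto
qed

lemma payoff_open:
  "payoff \<omega> = (LBINT k:{0<..t}. r (production_rate lam f u x t \<omega> k)) - cm (level lam f u x t \<omega> 0)"
proof -
  have [measurable]: "(\<lambda>k. r (production_rate lam f u x t \<omega> k)) \<in> borel_measurable borel"
    using measurable_Pair2[OF reward_measurable, of \<omega>] by simp
  have "(LBINT k:{0..t}. r (production_rate lam f u x t \<omega> k)) = (LBINT k:{0<..t}. r (production_rate lam f u x t \<omega> k))"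
    unfolding set_lebesgue_integral_def
  proof (rule integral_cong_AE)
    show "AE k in lborel. indicator {0..t} k *\<^sub>R r (production_rate lam f u x t \<omega> k)
        = indicator {0<..t} k *\<^sub>R r (production_rate lam f u x t \<omega> k)"
      using AE_lborel_singleton[of 0] by eventually_elim (auto simp: indicator_def)
  qed auto
  then show ?thesis
    by (simp add: payoff_def)
qed

text \<open>Since \<open>Suc (\<xi> - x)\<close> jumps would lead beyond failure, the second branch
  of \<open>fair_reward_telescopes\<close> applies almost surely at that index. The final level is
  at most \<open>\<xi>\<close>, so its value at time \<open>0\<close> is the negative maintenance
  cost.\<close>

lemma AE_fair_payoff:
  "AE \<omega> in clocks. set_integrable lborel {0<..t} (fair_reward \<omega>) \<and>
     V x t + (\<Sum>m\<le>\<xi> - x. increment m \<omega>)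
       = (LBINT k:{0<..t}. fair_reward \<omega> k) - cm (level lam f u x t \<omega> 0)"
  using AE_failed AE_level_le
proof eventually_elim
  case (elim \<omega>)
  then have "level lam f u x t \<omega> 0 \<le> \<xi>"
    using t_nonneg by auto
  then show ?case
    using fair_reward_telescopes[of "Suc (\<xi> - x)" \<omega>] elim(1) hjb_solution_init[OF sol]
    by (simp add: lessThan_Suc_atMost)
qed

lemma fair_payoff_mean: "(\<integral>\<omega>. V x t + (\<Sum>m\<le>\<xi> - x. increment m \<omega>) \<partial>clocks) = V x t"
proof -
  interpret clocks: prob_space clocks
    by (rule prob_space_clocks)
  have "(\<integral>\<omega>. V x t + (\<Sum>m\<le>\<xi> - x. increment m \<omega>) \<partial>clocks)
      = V x t + (\<integral>\<omega>. (\<Sum>m\<le>\<xi> - x. increment m \<omega>) \<partial>clocks)"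
    using clocks.prob_space by (simp add: increment_integrable)
  also have "\<dots> = V x t"
    by (simp add: increment_integrable increment_mean_zero)
  finally show ?thesis .
qed

lemma policy_value_eq_payoff: "policy_value f r cm lam u x t = (\<integral>\<omega>. payoff \<omega> \<partial>clocks)"
  by (simp add: policy_value_def payoff_def)

lemma payoff_integrable: "integrable clocks payoff"
proof -
  interpret clocks: prob_space clocks
    by (rule prob_space_clocks)
  obtain C where C: "0 \<le> C" "\<And>\<omega> k. \<bar>r (production_rate lam f u x t \<omega> k)\<bar> \<le> C"
    using reward_bound by blast
  have "AE \<omega> in clocks. norm (payoff \<omega>) \<le> C * (t - 0) + Max ((\<lambda>y. \<bar>cm y\<bar>) ` {..\<xi>})"
    using AE_level_le
  proof eventually_elim
    case (elim \<omega>)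
    have "(\<lambda>k. r (production_rate lam f u x t \<omega> k)) \<in> borel_measurable borel"
      using measurable_Pair2[OF reward_measurable, of \<omega>] by simp
    then have "\<bar>LBINT k:{0..t}. r (production_rate lam f u x t \<omega> k)\<bar> \<le> C * (t - 0)"
      using C t_nonneg by (intro abs_set_integral_le_on_Icc) auto
    moreover have "\<bar>cm (level lam f u x t \<omega> 0)\<bar> \<le> Max ((\<lambda>y. \<bar>cm y\<bar>) ` {..\<xi>})"
      using elim t_nonneg by (intro Max_ge) auto
    ultimately show ?case
      unfolding payoff_def by simp
  qed
  then show ?thesis
    by (rule clocks.integrable_const_bound[OF _ payoff_measurable])
qed

lemma policy_value_le: "policy_value f r cm lam u x t \<le> V x t"
proof -
  interpret clocks: prob_space clocks
    by (rule prob_space_clocks)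
  have "(\<integral>\<omega>. payoff \<omega> \<partial>clocks) \<le> (\<integral>\<omega>. V x t + (\<Sum>m\<le>\<xi> - x. increment m \<omega>) \<partial>clocks)"
  proof (rule integral_mono_AE[OF payoff_integrable])
    show "AE \<omega> in clocks. payoff \<omega> \<le> V x t + (\<Sum>m\<le>\<xi> - x. increment m \<omega>)"
      using AE_fair_payoff AE_level_le
    proof eventually_elim
      case (elim \<omega>)
      then have "(LBINT k:{0<..t}. r (production_rate lam f u x t \<omega> k)) \<le> (LBINT k:{0<..t}. fair_reward \<omega> k)"
        by (intro set_integral_mono reward_integrable reward_le_fair) auto
      then show ?case
        using elim(1) by (simp add: payoff_open)
    qed
  qed (auto intro!: increment_integrable)
  then show ?thesis
    by (simp add: policy_value_eq_payoff fair_payoff_mean)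
qed

lemma policy_value_optimal:
  assumes "\<And>y h k. y < \<xi> \<Longrightarrow> u y h k \<in> maximizers (lam * gap V y k)"
  shows "policy_value f r cm lam u x t = V x t"
proof -
  have "(\<integral>\<omega>. payoff \<omega> \<partial>clocks) = (\<integral>\<omega>. V x t + (\<Sum>m\<le>\<xi> - x. increment m \<omega>) \<partial>clocks)"
  proof (rule integral_cong_AE[OF payoff_measurable])
    show "AE \<omega> in clocks. payoff \<omega> = V x t + (\<Sum>m\<le>\<xi> - x. increment m \<omega>)"
      using AE_fair_payoff AE_level_le
    proof eventually_elim
      case (elim \<omega>)
      then have "(LBINT k:{0<..t}. r (production_rate lam f u x t \<omega> k)) = (LBINT k:{0<..t}. fair_reward \<omega> k)"
        by (intro set_lebesgue_integral_cong) (auto simp: reward_eq_fair[OF assms])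
      then show ?case
        using elim(1) by (simp add: payoff_open)
    qed
  qed auto
  then show ?thesis
    by (simp add: policy_value_eq_payoff fair_payoff_mean)
qed

end

section \<open>Identification of the optimal value and of the optimal rates\<close>

context production
begin

text \<open>Verification takes the starting time as the horizon, whereas monotonicity in time
  compares two moments on one solution with a longer horizon.\<close>

lemma hjb_solution_restrict:
  assumes sol: "hjb_solution \<xi> cm lam T V" and "T' \<le> T"
  shows "hjb_solution \<xi> cm lam T' V"
proof -
  have deriv: "(V y has_real_derivative d) (at k within {0..T'})"
    if "(V y has_real_derivative d) (at k within {0..T})" for y d k
    using that by (rule DERIV_subset) (use \<open>T' \<le> T\<close> in auto)
  have "\<forall>y<\<xi>. \<forall>t\<in>{0..T'}.
      (V y has_real_derivative H (lam * (V y t - V (Suc y) t))) (at t within {0..T'})"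
    using \<open>T' \<le> T\<close> by (auto intro!: deriv hjb_solution_deriv[OF sol])
  moreover have "\<forall>t\<in>{0..T'}. (V \<xi> has_real_derivative r 0) (at t within {0..T'})"
    using \<open>T' \<le> T\<close> by (auto intro!: deriv hjb_solution_deriv_failed[OF sol])
  ultimately show ?thesis
    using sol unfolding hjb_solution_def by (elim conjE) (intro conjI)
qed

definition feedback :: "nat \<Rightarrow> real \<Rightarrow> (nat \<Rightarrow> real \<Rightarrow> real) \<Rightarrow> policy" where
  "feedback \<xi> lam V y h k = (if y < \<xi> then Sup (maximizers (lam * gap V y k)) else 0)"

lemma feedback_range: "feedback \<xi> lam V y h k \<in> {0..sbar}"
  using select_maximizers[of Sup "lam * gap V y k"] sbar_pos
  by (auto simp: feedback_def maximizers_def)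

text \<open>Monotonicity replaces a measurable selection theorem: the largest maximizer is antitone
  in the price, hence Borel.\<close>

lemma feedback_measurable:
  assumes "\<And>y. continuous_on UNIV (V y)"
  shows "(\<lambda>(h, k). feedback \<xi> lam V y h k) \<in> borel_measurable (M \<Otimes>\<^sub>M borel)"
proof -
  have "mono (\<lambda>d. - Sup (maximizers d))"
    by (intro monoI) (simp add: select_maximizers_antimono)
  then have "(\<lambda>d. - (- Sup (maximizers d))) \<in> borel_measurable borel"
    by (intro borel_measurable_uminus borel_measurable_mono)
  then have [measurable]: "(\<lambda>d. Sup (maximizers d)) \<in> borel_measurable borel"
    by simp
  have [measurable]: "V y \<in> borel_measurable borel" for y
    by (intro borel_measurable_continuous_onI assms)
  show ?thesis
    unfolding feedback_def by measurable
qed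

lemma feedback_in_policies:
  assumes "hjb_solution \<xi> cm lam T V" "0 \<le> lam"
  shows "feedback \<xi> lam V \<in> policies \<xi> sbar f lam"
proof -
  have meas: "(\<lambda>(h, k). feedback \<xi> lam V y h k) \<in> borel_measurable ((\<Pi>\<^sub>M z\<in>{x..y}. borel) \<Otimes>\<^sub>M borel)" for x y
    by (intro feedback_measurable hjb_solution_cont[OF assms(1)])
  have "AE \<omega> in clocks. \<forall>k\<in>{0..t}. level lam f (feedback \<xi> lam V) x t \<omega> k \<le> \<xi>"
    if "x \<le> \<xi>" "0 \<le> t" for x t
  proof -
    interpret controlled_process sbar f r lam "feedback \<xi> lam V" x t
      by unfold_locales (rule assms meas feedback_range that)+
    show ?thesis
      by (rule AE_level_le_failure[OF that(1)]) (simp add: feedback_def)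
  qed
  moreover have "\<forall>h k. feedback \<xi> lam V \<xi> h k = 0"
    by (simp add: feedback_def)
  ultimately show ?thesis
    unfolding policies_def using meas feedback_range by blast
qed

text \<open>\<open>V\<close> bounds all policies and is attained by feedback, so the supremum is a
  maximum. It follows that solutions agree on the levels up to \<open>\<xi>\<close>, and each
  monotonicity claim may choose its own.\<close>

lemma optimal_value_eq:
  assumes sol: "hjb_solution \<xi> cm lam t V" and "0 \<le> lam" "0 \<le> t" "x \<le> \<xi>"
  shows "optimal_value \<xi> sbar f r cm lam x t = V x t"
proof -
  have val: "controlled_value sbar f r lam u x t \<xi> cm V" if "u \<in> policies \<xi> sbar f lam" for u
    using that assms by unfold_locales (auto simp: policies_def)
  have "policy_value f r cm lam (feedback \<xi> lam V) x t = V x t"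
    by (rule controlled_value.policy_value_optimal[OF val[OF feedback_in_policies[OF sol \<open>0 \<le> lam\<close>]]])
       (simp add: feedback_def select_maximizers)
  then have "V x t \<in> (\<lambda>u. policy_value f r cm lam u x t) ` policies \<xi> sbar f lam"
    using feedback_in_policies[OF sol \<open>0 \<le> lam\<close>] by (metis imageI)
  then show ?thesis
    unfolding optimal_value_def using controlled_value.policy_value_le[OF val]
    by (intro cSup_eq_maximum) auto
qed

lemma optimal_rates_eq:
  assumes sol: "hjb_solution \<xi> cm lam T V" and "0 \<le> lam" "t \<in> {0..T}" "x < \<xi>"
  shows "optimal_rates \<xi> sbar f r cm lam x t = maximizers (lam * gap V x t)"
proof -
  have sol_t: "hjb_solution \<xi> cm lam t V"
    by (rule hjb_solution_restrict[OF sol]) (use assms in auto)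
  have "value_difference \<xi> sbar f r cm lam x t = gap V x t"
    using optimal_value_eq[OF sol_t, of x] optimal_value_eq[OF sol_t, of "Suc x"] assms
    by (simp add: value_difference_def)
  then show ?thesis
    using \<open>x < \<xi>\<close> arg_max_eq_maximizers[of "lam * gap V x t"] by (simp add: optimal_rates_def mult_ac)
qed

end

theorem theorem1:
  fixes \<xi> :: nat and sbar :: real and f r :: "real \<Rightarrow> real" and cm :: "nat \<Rightarrow> real"
    and select :: "real set \<Rightarrow> real"
  assumes "0 < sbar"
    and "continuous_on {0..sbar} f" and "mono_on {0..sbar} f"
    and "\<forall>s\<in>{0..sbar}. 0 \<le> f s" and "f 0 = 0"
    and "continuous_on {0..sbar} r" and "mono_on {0..sbar} r" and "r 0 \<le> 0"
    and "\<forall>x\<le>\<xi>. 0 \<le> cm x" and "mono_on {..\<xi>} cm"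
    and "\<forall>x. x + 2 \<le> \<xi> \<longrightarrow> cm (x + 1) - cm x \<le> cm (x + 2) - cm (x + 1)"
    and "select \<in> {Sup, Inf}"
  defines "s \<equiv> optimal_rate select \<xi> sbar f r cm"
  shows "(\<forall>lam\<ge>0. \<forall>x\<le>\<xi>. \<forall>t\<ge>0. s lam x t \<in> optimal_rates \<xi> sbar f r cm lam x t)
    \<and> (\<forall>lam\<ge>0. \<forall>t\<ge>0. antimono_on {..\<xi>} (\<lambda>x. s lam x t))
    \<and> (\<forall>lam\<ge>0. \<forall>x\<le>\<xi>. antimono_on {0..} (\<lambda>t. s lam x t))
    \<and> (\<forall>x\<le>\<xi>. \<forall>t\<ge>0. antimono_on {0..} (\<lambda>lam. s lam x t))"
proof -
  interpret production sbar f r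
    using assms by unfold_locales auto
  have convex: "cm (x + 1) - cm x \<le> cm (x + 2) - cm (x + 1)" if "x + 2 \<le> \<xi>" for x
    using assms that by blast
  have s_failed: "s lam \<xi> t = 0" for lam t
    using \<open>select \<in> {Sup, Inf}\<close> by (auto simp: s_def optimal_rate_def optimal_rates_def)
  have s_eq: "s lam x t = select (maximizers (lam * gap V x t))"
    if "hjb_solution \<xi> cm lam T V" "0 \<le> lam" "t \<in> {0..T}" "x < \<xi>" for lam T V t x
    using optimal_rates_eq[OF that] by (simp add: s_def optimal_rate_def)
  have mem: "s lam x t \<in> optimal_rates \<xi> sbar f r cm lam x t" if "0 \<le> lam" "x \<le> \<xi>" "0 \<le> t" for lam x t
  proof (cases "x < \<xi>")
    case True
    obtain V where V: "hjb_solution \<xi> cm lam t V"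
      by (rule hjb_solution_exists[OF \<open>0 \<le> lam\<close> \<open>0 \<le> t\<close>])
    then show ?thesis
      using s_eq[OF V] optimal_rates_eq[OF V] select_maximizers[OF \<open>select \<in> {Sup, Inf}\<close>] that True by simp
  next
    case False
    then show ?thesis
      using that s_failed by (simp add: optimal_rates_def)
  qed
  \<comment> \<open>Needed where the higher of two compared levels is \<open>\<xi>\<close>, whose
    rate is \<open>0\<close>.\<close>
  have nonneg: "0 \<le> s lam x t" if "0 \<le> lam" "x \<le> \<xi>" "0 \<le> t" for lam x t
    using mem[OF that] by (auto simp: optimal_rates_def is_arg_max_def split: if_splits)
  have level: "s lam y t \<le> s lam x t" if "0 \<le> lam" "0 \<le> t" "x \<le> y" "y \<le> \<xi>" for lam t x y
  proof (cases "y < \<xi>")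
    case True
    obtain V where V: "hjb_solution \<xi> cm lam t V"
      by (rule hjb_solution_exists[OF \<open>0 \<le> lam\<close> \<open>0 \<le> t\<close>])
    have "gap V x t \<le> gap V y t"
      using that True by (intro gap_mono_level[OF V _ convex]) auto
    then have "select (maximizers (lam * gap V y t)) \<le> select (maximizers (lam * gap V x t))"
      using that by (intro select_maximizers_antimono assms mult_left_mono)
    then show ?thesis
      using s_eq[OF V] that True by simp
  next
    case False
    then show ?thesis
      using nonneg[of lam x t] s_failed that by simp
  qed
  have time: "s lam x t' \<le> s lam x t" if "0 \<le> lam" "x \<le> \<xi>" "0 \<le> t" "t \<le> t'" for lam x t t'
  proof (cases "x < \<xi>")
    case True
    have "0 \<le> t'"
      using that by simp
    \<comment> \<open>A solution up to the later moment \<open>t'\<close> describes the optimal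
      rates at both moments.\<close>
    obtain V where V: "hjb_solution \<xi> cm lam t' V"
      by (rule hjb_solution_exists[OF \<open>0 \<le> lam\<close> \<open>0 \<le> t'\<close>])
    have "gap V x t \<le> gap V x t'"
      using that True by (intro gap_mono_time[OF V _ convex]) auto
    then have "select (maximizers (lam * gap V x t')) \<le> select (maximizers (lam * gap V x t))"
      using that by (intro select_maximizers_antimono assms mult_left_mono)
    then show ?thesis
      using s_eq[OF V] that True by simp
  next
    case False
    then show ?thesis
      using s_failed that by simp
  qed
  have base_rate: "s lam' x t \<le> s lam x t" if "x \<le> \<xi>" "0 \<le> t" "0 \<le> lam" "lam \<le> lam'" for lam lam' x t
  proof (cases "x < \<xi>")
    case True
    obtain V where V: "hjb_solution \<xi> cm lam t V"
      by (rule hjb_solution_exists[OF \<open>0 \<le> lam\<close> \<open>0 \<le> t\<close>])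
    have "0 \<le> lam'"
      using that by simp
    obtain V' where V': "hjb_solution \<xi> cm lam' t V'"
      by (rule hjb_solution_exists[OF \<open>0 \<le> lam'\<close> \<open>0 \<le> t\<close>])
    have "lam * gap V x t \<le> lam' * gap V' x t"
      using that True by (intro scaled_gap_mono_rate[OF V V' _ _ convex] assms) auto
    then have "select (maximizers (lam' * gap V' x t)) \<le> select (maximizers (lam * gap V x t))"
      by (intro select_maximizers_antimono assms)
    then show ?thesis
      using s_eq[OF V] s_eq[OF V'] that True by simp
  next
    case False
    then show ?thesis
      using s_failed that by simp
  qed
  show ?thesis
    using mem level time base_rate by (auto intro!: monotone_onI)
qed

end
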